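(* Let $\Gamma$ be a set of second-order formulas (a context) and $A$ a second-order formula, and let $k\in\{i,c\}$. If $\Gamma^*,SC_1\vdash^1_k A^*$, then $\Gamma\vdash^2_k A$.
   Context: The second-order language $\mathcal L_2$ has logical symbols $\bot,\to,\wedge,\vee,\forall,\exists$; a countable set $\mathcal V$ of first-order variables; a countable set $\Sigma$ of function symbols (constants have arity $0$), from which terms are built; and for each $n\in\mathbb N$ a countable set $\mathcal V_n$ of second-order variables of arity $n$. Its atomic formulas are $\bot$ and $X^n(t_1,\dots,t_n)$, and it has quantification over first-order variables and over second-order variables of every arity. The first-order language $\mathcal L_1$ has the same $\mathcal V$, $\Sigma$ and logical symbols, and for each $n\in\mathbb N$ one relation symbol $\mathrm{Ap}_n$ of arity $n+1$ (and no others). $\mathrm{Free}(F)$ denotes the set of free variables, and $F\leftrightarrow G$ abbreviates $(F\to G)\wedge(G\to F)$. $\Gamma\vdash^n_k F$ denotes natural-deduction derivability, in first-order logic over $\mathcal L_1$ for $n=1$ and in second-order logic over $\mathcal L_2$ for $n=2$ (where second-order $\forall$-elimination and $\exists$-introduction instantiate $X^n$ by an arbitrary abstraction $\lambda x_1\dots x_n\,G$); the logic is intuitionistic for $k=i$ and classical for $k=c$. Fix for each $n$ a bijection $\phi_n:\mathcal V_n\to\mathcal V$. The coding $F\mapsto F^*$ of $\mathcal L_2$-formulas into $\mathcal L_1$-formulas is defined by: - $\bot^*=\bot$ and $(X^n(t_1,\dots,t_n))^*=\mathrm{Ap}_n(\phi_n(X^n),t_1,\dots,t_n)$. - $(A\diamond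 B)^*=A^*\diamond B^*$ for $\diamond\in\{\to,\wedge,\vee\}$. - $(Qx\,A)^*=Qy\,(A[x:=y])^*$ for a variable $y\notin\mathrm{Free}(A^* )$. - $(QX^n\,A)^*=Qy\,(A[X^n:=Y^n])^*$, where $\phi_n(Y^n)=y$ and $y\notin\mathrm{Free}(A^* )$. Here $Q\in\{\forall,\exists\}$. For a set of formulas, $\Gamma^*=\{F^*:F\in\Gamma\}$. $SC_2$ is the set of all closed $\mathcal L_2$-formulas $\forall\chi_1\dots\forall\chi_m\,\exists X^n\,\forall x_1\dots\forall x_n\,(G\leftrightarrow X^n(x_1,\dots,x_n))$, where $x_j\in\mathcal V$, the $\chi_j$ are first- or second-order variables, $\mathrm{Free}(G)\subseteq\{x_1,\dots,x_n,\chi_1,\dots,\chi_m\}$, and $X^n\notin\mathrm{Free}(G)$. Finally, $SC_1=\{F^*:F\in SC_2\}$. *)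

theory Defs
  imports "HOL-Library.Countable_Set"
begin

section \<open>Syntax\<close>

text \<open>
  Both the set of first-order variables and, for each \<open>n\<close>, the set of second-order variables of
  arity \<open>n\<close> are countably infinite and represented by \<^typ>\<open>nat\<close>. A second-order variable is identified
  by its arity together with its name. A signature is a set of pairs of a function symbol and its arity.
\<close>

type_synonym fvar = nat
type_synonym svar = nat
type_synonym 'f signature = "('f \<times> nat) set"

datatype 'f tm = Var fvar | Fn 'f "'f tm list"

datatype var2 = FO fvar | SO nat svar

datatype conn = Imp | Conj | Disj
datatype quant = Forall | Exists

text \<open>
  \<open>Ap t ts\<close> is the atom built from the relation symbol of arity \<open>length ts + 1\<close>, and
  \<open>Atom2 X ts\<close> the atom built from the second-order variable \<open>X\<close> of arity \<open>length ts\<close>.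
\<close>

datatype 'f fm1 =
    Bot1
  | Ap "'f tm" "'f tm list"
  | Bin1 conn "'f fm1" "'f fm1"
  | Q1 quant fvar "'f fm1"

datatype 'f fm2 =
    Bot2
  | Atom2 svar "'f tm list"
  | Bin2 conn "'f fm2" "'f fm2"
  | Q2 quant var2 "'f fm2"

definition Iff2 :: "'f fm2 \<Rightarrow> 'f fm2 \<Rightarrow> 'f fm2" where
  "Iff2 F G = Bin2 Conj (Bin2 Imp F G) (Bin2 Imp G F)"

primrec wft :: "'f signature \<Rightarrow> 'f tm \<Rightarrow> bool" where
  "wft S (Var x) \<longleftrightarrow> True"
| "wft S (Fn f ts) \<longleftrightarrow> (f, length ts) \<in> S \<and> list_all (wft S) ts"

primrec wf1 :: "'f signature \<Rightarrow> 'f fm1 \<Rightarrow> bool" where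
  "wf1 S Bot1 \<longleftrightarrow> True"
| "wf1 S (Ap t ts) \<longleftrightarrow> wft S t \<and> list_all (wft S) ts"
| "wf1 S (Bin1 c A B) \<longleftrightarrow> wf1 S A \<and> wf1 S B"
| "wf1 S (Q1 q x A) \<longleftrightarrow> wf1 S A"

primrec wf2 :: "'f signature \<Rightarrow> 'f fm2 \<Rightarrow> bool" where
  "wf2 S Bot2 \<longleftrightarrow> True"
| "wf2 S (Atom2 X ts) \<longleftrightarrow> list_all (wft S) ts"
| "wf2 S (Bin2 c A B) \<longleftrightarrow> wf2 S A \<and> wf2 S B"
| "wf2 S (Q2 q v A) \<longleftrightarrow> wf2 S A"

primrec fvt :: "'f tm \<Rightarrow> fvar set" where
  "fvt (Var x) = {x}"
| "fvt (Fn f ts) = \<Union> (set (map fvt ts))"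

definition fvts :: "'f tm list \<Rightarrow> fvar set" where
  "fvts ts = (\<Union>t\<in>set ts. fvt t)"

primrec free1 :: "'f fm1 \<Rightarrow> fvar set" where
  "free1 Bot1 = {}"
| "free1 (Ap t ts) = fvt t \<union> fvts ts"
| "free1 (Bin1 c A B) = free1 A \<union> free1 B"
| "free1 (Q1 q x A) = free1 A - {x}"

primrec free2 :: "'f fm2 \<Rightarrow> var2 set" where
  "free2 Bot2 = {}"
| "free2 (Atom2 X ts) = insert (SO (length ts) X) (FO ` fvts ts)"
| "free2 (Bin2 c A B) = free2 A \<union> free2 B"
| "free2 (Q2 q v A) = free2 A - {v}"


section \<open>Capture-avoiding substitution\<close>

primrec tsubst :: "(fvar \<Rightarrow> 'f tm) \<Rightarrow> 'f tm \<Rightarrow> 'f tm" where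
  "tsubst \<sigma> (Var x) = \<sigma> x"
| "tsubst \<sigma> (Fn f ts) = Fn f (map (tsubst \<sigma>) ts)"

definition variant :: "nat set \<Rightarrow> nat \<Rightarrow> nat" where
  "variant W x = (if x \<in> W then LEAST y. y \<notin> W else x)"

text \<open>
  The first argument of \<open>subst1\<close> and \<open>subst2\<close> is a finite set of variables that bound variables have
  to avoid: a bound variable in this set is renamed. It must contain the free variables of the
  formula and of all the objects substituted into it.
\<close>

primrec subst1 :: "fvar set \<Rightarrow> (fvar \<Rightarrow> 'f tm) \<Rightarrow> 'f fm1 \<Rightarrow> 'f fm1" where
  "subst1 W \<sigma> Bot1 = Bot1"
| "subst1 W \<sigma> (Ap t ts) = Ap (tsubst \<sigma> t) (map (tsubst \<sigma>) ts)"
| "subst1 W \<sigma> (Bin1 c A B) = Bin1 c (subst1 W \<sigma> A) (subst1 W \<sigma> B)"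
| "subst1 W \<sigma> (Q1 q x A) =
    (let y = variant W x in Q1 q y (subst1 (insert y W) (\<sigma>(x := Var y)) A))"

definition fosubst1 :: "fvar \<Rightarrow> 'f tm \<Rightarrow> 'f fm1 \<Rightarrow> 'f fm1" where
  "fosubst1 x t A = subst1 (free1 A \<union> fvt t) (Var(x := t)) A"

text \<open>
  Simultaneous substitution of terms for first-order variables (\<open>\<sigma>\<close>) and of predicates for
  second-order variables (\<open>\<tau>\<close>); a predicate is given as a function from argument lists to formulas,
  so that the identity is \<open>Atom2\<close>. The function \<open>upd \<tau> n X P\<close> changes \<open>\<tau>\<close> only at the variable \<open>X\<close> of
  arity \<open>n\<close>.
\<close>

definition upd ::
  "(svar \<Rightarrow> 'f tm list \<Rightarrow> 'f fm2) \<Rightarrow> nat \<Rightarrow> svar \<Rightarrow> ('f tm list \<Rightarrow> 'f fm2) \<Rightarrow>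
    svar \<Rightarrow> 'f tm list \<Rightarrow> 'f fm2" where
  "upd \<tau> n X P = (\<lambda>Z ts. if Z = X \<and> length ts = n then P ts else \<tau> Z ts)"

primrec subst2 ::
  "var2 set \<Rightarrow> (fvar \<Rightarrow> 'f tm) \<Rightarrow> (svar \<Rightarrow> 'f tm list \<Rightarrow> 'f fm2) \<Rightarrow> 'f fm2 \<Rightarrow> 'f fm2" where
  "subst2 W \<sigma> \<tau> Bot2 = Bot2"
| "subst2 W \<sigma> \<tau> (Atom2 X ts) = \<tau> X (map (tsubst \<sigma>) ts)"
| "subst2 W \<sigma> \<tau> (Bin2 c A B) = Bin2 c (subst2 W \<sigma> \<tau> A) (subst2 W \<sigma> \<tau> B)"
| "subst2 W \<sigma> \<tau> (Q2 q v A) =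
    (case v of
      FO x \<Rightarrow> let y = variant (FO -` W) x
              in Q2 q (FO y) (subst2 (insert (FO y) W) (\<sigma>(x := Var y)) \<tau> A)
    | SO n X \<Rightarrow> let Y = variant (SO n -` W) X
              in Q2 q (SO n Y) (subst2 (insert (SO n Y) W) \<sigma> (upd \<tau> n X (Atom2 Y)) A))"

definition fosubst2 :: "fvar \<Rightarrow> 'f tm \<Rightarrow> 'f fm2 \<Rightarrow> 'f fm2" where
  "fosubst2 x t A = subst2 (free2 A \<union> FO ` fvt t) (Var(x := t)) Atom2 A"

definition sorename :: "nat \<Rightarrow> svar \<Rightarrow> svar \<Rightarrow> 'f fm2 \<Rightarrow> 'f fm2" where
  "sorename n X Y A = subst2 (insert (SO n Y) (free2 A)) Var (upd Atom2 n X (Atom2 Y)) A"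

text \<open>
  \<open>abstr xs G\<close> is the abstraction \<open>\<lambda>xs. G\<close>, which maps \<open>ts\<close> to \<open>G[xs := ts]\<close>, and
  \<open>sosubst X xs G A\<close> is \<open>A[X := \<lambda>xs. G]\<close>, the arity of \<open>X\<close> being the length of \<open>xs\<close>.
\<close>

definition abstr :: "fvar list \<Rightarrow> 'f fm2 \<Rightarrow> 'f tm list \<Rightarrow> 'f fm2" where
  "abstr xs G ts =
    subst2 (free2 G \<union> FO ` fvts ts)
      (\<lambda>x. case map_of (zip xs ts) x of Some t \<Rightarrow> t | None \<Rightarrow> Var x) Atom2 G"

definition sosubst :: "svar \<Rightarrow> fvar list \<Rightarrow> 'f fm2 \<Rightarrow> 'f fm2 \<Rightarrow> 'f fm2" where
  "sosubst X xs G A =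
    subst2 (free2 A \<union> free2 G) Var (upd Atom2 (length xs) X (abstr xs G)) A"


section \<open>Natural deduction\<close>

text \<open>
  Sequents have finite contexts; a formula is derivable from an arbitrary set of formulas iff it is
  derivable from a finite subset, so that eigenvariable conditions only concern the assumptions
  actually used. The eigenvariable \<open>y\<close> of a quantifier rule may differ from the bound variable; this
  makes alpha-equivalent formulas interderivable.
\<close>

datatype logic = Intuitionistic | Classical

inductive nd1 :: "'f signature \<Rightarrow> logic \<Rightarrow> 'f fm1 set \<Rightarrow> 'f fm1 \<Rightarrow> bool" for S k where
  Assm: "finite \<Gamma> \<Longrightarrow> \<forall>F\<in>\<Gamma>. wf1 S F \<Longrightarrow> A \<in> \<Gamma> \<Longrightarrow> nd1 S k \<Gamma> A"
| BotE: "nd1 S k \<Gamma> Bot1 \<Longrightarrow> wf1 S A \<Longrightarrow> nd1 S k \<Gamma> A"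
| RAA: "k = Classical \<Longrightarrow> nd1 S k (insert (Bin1 Imp A Bot1) \<Gamma>) Bot1 \<Longrightarrow> nd1 S k \<Gamma> A"
| ImpI: "nd1 S k (insert A \<Gamma>) B \<Longrightarrow> nd1 S k \<Gamma> (Bin1 Imp A B)"
| ImpE: "nd1 S k \<Gamma> (Bin1 Imp A B) \<Longrightarrow> nd1 S k \<Gamma> A \<Longrightarrow> nd1 S k \<Gamma> B"
| ConjI: "nd1 S k \<Gamma> A \<Longrightarrow> nd1 S k \<Gamma> B \<Longrightarrow> nd1 S k \<Gamma> (Bin1 Conj A B)"
| ConjE1: "nd1 S k \<Gamma> (Bin1 Conj A B) \<Longrightarrow> nd1 S k \<Gamma> A"
| ConjE2: "nd1 S k \<Gamma> (Bin1 Conj A B) \<Longrightarrow> nd1 S k \<Gamma> B"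
| DisjI1: "nd1 S k \<Gamma> A \<Longrightarrow> wf1 S B \<Longrightarrow> nd1 S k \<Gamma> (Bin1 Disj A B)"
| DisjI2: "nd1 S k \<Gamma> B \<Longrightarrow> wf1 S A \<Longrightarrow> nd1 S k \<Gamma> (Bin1 Disj A B)"
| DisjE: "nd1 S k \<Gamma> (Bin1 Disj A B) \<Longrightarrow> nd1 S k (insert A \<Gamma>) C \<Longrightarrow> nd1 S k (insert B \<Gamma>) C \<Longrightarrow>
    nd1 S k \<Gamma> C"
| AllI: "nd1 S k \<Gamma> (fosubst1 x (Var y) A) \<Longrightarrow> \<forall>F \<in> insert (Q1 Forall x A) \<Gamma>. y \<notin> free1 F \<Longrightarrow>
    nd1 S k \<Gamma> (Q1 Forall x A)"
| AllE: "nd1 S k \<Gamma> (Q1 Forall x A) \<Longrightarrow> wft S t \<Longrightarrow> nd1 S k \<Gamma> (fosubst1 x t A)"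
| ExI: "nd1 S k \<Gamma> (fosubst1 x t A) \<Longrightarrow> wft S t \<Longrightarrow> wf1 S A \<Longrightarrow> nd1 S k \<Gamma> (Q1 Exists x A)"
| ExE: "nd1 S k \<Gamma> (Q1 Exists x A) \<Longrightarrow> nd1 S k (insert (fosubst1 x (Var y) A) \<Gamma>) C \<Longrightarrow>
    \<forall>F \<in> {Q1 Exists x A, C} \<union> \<Gamma>. y \<notin> free1 F \<Longrightarrow> nd1 S k \<Gamma> C"

inductive nd2 :: "'f signature \<Rightarrow> logic \<Rightarrow> 'f fm2 set \<Rightarrow> 'f fm2 \<Rightarrow> bool" for S k where
  Assm: "finite \<Gamma> \<Longrightarrow> \<forall>F\<in>\<Gamma>. wf2 S F \<Longrightarrow> A \<in> \<Gamma> \<Longrightarrow> nd2 S k \<Gamma> A"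
| BotE: "nd2 S k \<Gamma> Bot2 \<Longrightarrow> wf2 S A \<Longrightarrow> nd2 S k \<Gamma> A"
| RAA: "k = Classical \<Longrightarrow> nd2 S k (insert (Bin2 Imp A Bot2) \<Gamma>) Bot2 \<Longrightarrow> nd2 S k \<Gamma> A"
| ImpI: "nd2 S k (insert A \<Gamma>) B \<Longrightarrow> nd2 S k \<Gamma> (Bin2 Imp A B)"
| ImpE: "nd2 S k \<Gamma> (Bin2 Imp A B) \<Longrightarrow> nd2 S k \<Gamma> A \<Longrightarrow> nd2 S k \<Gamma> B"
| ConjI: "nd2 S k \<Gamma> A \<Longrightarrow> nd2 S k \<Gamma> B \<Longrightarrow> nd2 S k \<Gamma> (Bin2 Conj A B)"
| ConjE1: "nd2 S k \<Gamma> (Bin2 Conj A B) \<Longrightarrow> nd2 S k \<Gamma> A"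
| ConjE2: "nd2 S k \<Gamma> (Bin2 Conj A B) \<Longrightarrow> nd2 S k \<Gamma> B"
| DisjI1: "nd2 S k \<Gamma> A \<Longrightarrow> wf2 S B \<Longrightarrow> nd2 S k \<Gamma> (Bin2 Disj A B)"
| DisjI2: "nd2 S k \<Gamma> B \<Longrightarrow> wf2 S A \<Longrightarrow> nd2 S k \<Gamma> (Bin2 Disj A B)"
| DisjE: "nd2 S k \<Gamma> (Bin2 Disj A B) \<Longrightarrow> nd2 S k (insert A \<Gamma>) C \<Longrightarrow> nd2 S k (insert B \<Gamma>) C \<Longrightarrow>
    nd2 S k \<Gamma> C"
| AllI: "nd2 S k \<Gamma> (fosubst2 x (Var y) A) \<Longrightarrow>
    \<forall>F \<in> insert (Q2 Forall (FO x) A) \<Gamma>. FO y \<notin> free2 F \<Longrightarrow> nd2 S k \<Gamma> (Q2 Forall (FO x) A)"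
| AllE: "nd2 S k \<Gamma> (Q2 Forall (FO x) A) \<Longrightarrow> wft S t \<Longrightarrow> nd2 S k \<Gamma> (fosubst2 x t A)"
| ExI: "nd2 S k \<Gamma> (fosubst2 x t A) \<Longrightarrow> wft S t \<Longrightarrow> wf2 S A \<Longrightarrow> nd2 S k \<Gamma> (Q2 Exists (FO x) A)"
| ExE: "nd2 S k \<Gamma> (Q2 Exists (FO x) A) \<Longrightarrow> nd2 S k (insert (fosubst2 x (Var y) A) \<Gamma>) C \<Longrightarrow>
    \<forall>F \<in> {Q2 Exists (FO x) A, C} \<union> \<Gamma>. FO y \<notin> free2 F \<Longrightarrow> nd2 S k \<Gamma> C"
| AllI2: "nd2 S k \<Gamma> (sorename n X Y A) \<Longrightarrow>
    \<forall>F \<in> insert (Q2 Forall (SO n X) A) \<Gamma>. SO n Y \<notin> free2 F \<Longrightarrow>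
    nd2 S k \<Gamma> (Q2 Forall (SO n X) A)"
| AllE2: "nd2 S k \<Gamma> (Q2 Forall (SO n X) A) \<Longrightarrow> distinct xs \<Longrightarrow> length xs = n \<Longrightarrow> wf2 S G \<Longrightarrow>
    nd2 S k \<Gamma> (sosubst X xs G A)"
| ExI2: "nd2 S k \<Gamma> (sosubst X xs G A) \<Longrightarrow> distinct xs \<Longrightarrow> length xs = n \<Longrightarrow> wf2 S G \<Longrightarrow>
    wf2 S A \<Longrightarrow> nd2 S k \<Gamma> (Q2 Exists (SO n X) A)"
| ExE2: "nd2 S k \<Gamma> (Q2 Exists (SO n X) A) \<Longrightarrow> nd2 S k (insert (sorename n X Y A) \<Gamma>) C \<Longrightarrow>
    \<forall>F \<in> {Q2 Exists (SO n X) A, C} \<union> \<Gamma>. SO n Y \<notin> free2 F \<Longrightarrow> nd2 S k \<Gamma> C"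

definition derives1 :: "'f signature \<Rightarrow> logic \<Rightarrow> 'f fm1 set \<Rightarrow> 'f fm1 \<Rightarrow> bool" where
  "derives1 S k \<Gamma> A \<longleftrightarrow> (\<exists>\<Delta>\<subseteq>\<Gamma>. finite \<Delta> \<and> nd1 S k \<Delta> A)"

definition derives2 :: "'f signature \<Rightarrow> logic \<Rightarrow> 'f fm2 set \<Rightarrow> 'f fm2 \<Rightarrow> bool" where
  "derives2 S k \<Gamma> A \<longleftrightarrow> (\<exists>\<Delta>\<subseteq>\<Gamma>. finite \<Delta> \<and> nd2 S k \<Delta> A)"


section \<open>The coding\<close>

text \<open>
  The defining clauses leave open which fresh variable is chosen at a quantifier. Hence
  \<open>is_coding \<phi> star\<close> says that \<open>star\<close> is a map obeying these clauses, for some choice of the variables.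
\<close>

definition is_coding ::
  "(nat \<Rightarrow> svar \<Rightarrow> fvar) \<Rightarrow> ('f fm2 \<Rightarrow> 'f fm1) \<Rightarrow> bool" where
  "is_coding \<phi> star \<longleftrightarrow>
    star Bot2 = Bot1 \<and>
    (\<forall>X ts. star (Atom2 X ts) = Ap (Var (\<phi> (length ts) X)) ts) \<and>
    (\<forall>c A B. star (Bin2 c A B) = Bin1 c (star A) (star B)) \<and>
    (\<forall>q x A. \<exists>y. y \<notin> free1 (star A) \<and>
      star (Q2 q (FO x) A) = Q1 q y (star (fosubst2 x (Var y) A))) \<and>
    (\<forall>q n X A. \<exists>y Y. \<phi> n Y = y \<and> y \<notin> free1 (star A) \<and>
      star (Q2 q (SO n X) A) = Q1 q y (star (sorename n X Y A)))"

definition SC2 :: "'f signature \<Rightarrow> 'f fm2 set" where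
  "SC2 S =
    {foldr (Q2 Forall) \<chi>s
      (Q2 Exists (SO (length xs) X)
        (foldr (\<lambda>x. Q2 Forall (FO x)) xs (Iff2 G (Atom2 X (map Var xs)))))
     | \<chi>s X xs G. wf2 S G \<and> free2 G \<subseteq> FO ` set xs \<union> set \<chi>s \<and> SO (length xs) X \<notin> free2 G}"

definition SC1 :: "('f fm2 \<Rightarrow> 'f fm1) \<Rightarrow> 'f signature \<Rightarrow> 'f fm1 set" where
  "SC1 star S = star ` SC2 S"


subsection \<open>Existence of codings\<close>

primrec depth :: "'f fm2 \<Rightarrow> nat" where
  "depth Bot2 = 0"
| "depth (Atom2 X ts) = 0"
| "depth (Bin2 c A B) = Suc (max (depth A) (depth B))"
| "depth (Q2 q v A) = Suc (depth A)"

lemma depth_subst2: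
  "(\<And>X ts. depth (\<tau> X ts) = 0) \<Longrightarrow> depth (subst2 W \<sigma> \<tau> A) = depth A"
  by (induction A arbitrary: W \<sigma> \<tau>) (auto simp: upd_def Let_def split: var2.split)

lemma depth_fosubst2 [simp]: "depth (fosubst2 x t A) = depth A"
  by (simp add: fosubst2_def depth_subst2)

lemma depth_sorename [simp]: "depth (sorename n X Y A) = depth A"
  by (simp add: sorename_def depth_subst2 upd_def)

lemma finite_fvt: "finite (fvt t)"
  by (induction t) auto

lemma finite_free1: "finite (free1 A)"
  by (induction A) (auto simp: finite_fvt fvts_def)

function code :: "(nat \<Rightarrow> svar \<Rightarrow> fvar) \<Rightarrow> 'f fm2 \<Rightarrow> 'f fm1" where
  "code \<phi> Bot2 = Bot1"
| "code \<phi> (Atom2 X ts) = Ap (Var (\<phi> (length ts) X)) ts"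
| "code \<phi> (Bin2 c A B) = Bin1 c (code \<phi> A) (code \<phi> B)"
| "code \<phi> (Q2 q (FO x) A) =
    (let y = (LEAST y. y \<notin> free1 (code \<phi> A)) in Q1 q y (code \<phi> (fosubst2 x (Var y) A)))"
| "code \<phi> (Q2 q (SO n X) A) =
    (let Y = (LEAST Y. \<phi> n Y \<notin> free1 (code \<phi> A)) in Q1 q (\<phi> n Y) (code \<phi> (sorename n X Y A)))"
  by pat_completeness auto
termination
  by (relation "Wellfounded.measure (\<lambda>(\<phi>, A). depth A)") auto

lemma ex_coding:
  assumes "\<forall>n. bij (\<phi> n)"
  shows "is_coding \<phi> (code \<phi>)"
proof -
  have fo: "(LEAST y. y \<notin> free1 B) \<notin> free1 B" for B :: "'a fm1"
    by (rule LeastI_ex) (metis finite_free1 ex_new_if_finite infinite_UNIV_nat)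
  have so: "\<phi> n (LEAST Y. \<phi> n Y \<notin> free1 B) \<notin> free1 B" for n and B :: "'a fm1"
  proof (rule LeastI_ex)
    obtain y where "y \<notin> free1 B"
      by (metis finite_free1 ex_new_if_finite infinite_UNIV_nat)
    then show "\<exists>Y. \<phi> n Y \<notin> free1 B"
      using assms by (metis bij_pointE)
  qed
  show ?thesis
    unfolding is_coding_def
    by (intro conjI allI, simp_all only: code.simps Let_def) (use fo so in blast)+
qed

end

(* Formulas of both languages are interpreted in one Heyting-valued model, whose truth values are
   sets of finite second-order contexts. A second-order formula is interpreted by the set of contexts
   proving it. An individual of the first-order model is a term together with one second-order
   variable of each arity, and Ap_n reads off the variable of arity n. A coded formula F*
   then gets the same value as F, and SC_1 holds because comprehension is
   provable in second-order logic. Soundness of first-order deduction in this model then turns a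
   derivation of A* into the statement that the context proves A. *)

theory Submission
  imports Defs
begin

text \<open>A rule-by-rule translation of the given derivation is obstructed by intermediate
  formulas that are codes of nothing: one variable may be both an argument and the head of atoms of
  several arities, and a compound term may stand in head position. In the model every first-order
  formula has a value, while individuals still project onto all well-formed terms and onto all
  second-order variables of each arity. A second obstacle is that a finite context may prove a
  disjunction or an existential formula without proving a disjunct or an instance, so plain unions
  are too small. The closure \<open>hcl\<close> tests membership against all conclusions
  \<open>D\<close>, just as the elimination rules do; this makes provability commute with the
  connectives and quantifiers in both logics. Second-order quantifiers range over variables only,
  which eigenvariables make sufficient. Arbitrary abstractions enter through comprehension alone,
  where the rule \<open>ExI2\<close> accepts them as witnesses.\<close>

lemma tsubst_cong: "(\<And>x. x \<in> fvt t \<Longrightarrow> \<sigma> x = \<sigma>' x) \<Longrightarrow> tsubst \<sigma> t = tsubst \<sigma>' t"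
  by (induction t) auto

lemma tsubst_Var [simp]: "tsubst Var t = t"
  by (induction t) (auto simp: map_idI)

lemma map_tsubst_Var [simp]: "map (tsubst Var) ts = ts"
  by (simp add: map_idI)

lemma tsubst_tsubst: "tsubst s (tsubst \<sigma> t) = tsubst (\<lambda>x. tsubst s (\<sigma> x)) t"
  by (induction t) auto

lemma wft_tsubst: "(\<And>x. wft S (\<sigma> x)) \<Longrightarrow> wft S (tsubst \<sigma> t) \<longleftrightarrow> wft S t"
  by (induction t) (auto simp: list_all_iff)

lemma variant_notin:
  assumes "finite W"
  shows "variant W x \<notin> W"
proof (cases "x \<in> W")
  case True
  have "\<exists>y. y \<notin> W"
    using assms by (metis ex_new_if_finite infinite_UNIV_nat)
  then have "(LEAST y. y \<notin> W) \<notin> W"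
    by (rule LeastI_ex)
  with True show ?thesis by (simp add: variant_def)
qed (simp add: variant_def)

lemma variant_FO_notin: "finite W \<Longrightarrow> FO (variant (FO -` W) x) \<notin> W"
  using variant_notin[of "FO -` W" x] finite_vimageI[of W FO] by (auto simp: inj_def)

lemma variant_SO_notin: "finite W \<Longrightarrow> SO n (variant (SO n -` W) X) \<notin> W"
  using variant_notin[of "SO n -` W" X] finite_vimageI[of W "SO n"] by (auto simp: inj_def)

lemma finite_fvts: "finite (fvts ts)"
  by (auto simp: fvts_def finite_fvt)

lemma finite_free2: "finite (free2 A)"
  by (induction A) (auto simp: finite_fvts)

lemma ex_fresh_var2:
  assumes "finite W" and "inj f"
  shows "\<exists>y :: nat. f y \<notin> (W :: var2 set)"
  by (metis assms ex_new_if_finite finite_vimageI infinite_UNIV_nat vimageI2)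

lemma wf1_subst1: "(\<And>x. wft S (\<sigma> x)) \<Longrightarrow> wf1 S (subst1 W \<sigma> A) \<longleftrightarrow> wf1 S A"
  by (induction A arbitrary: W \<sigma>) (auto simp: Let_def wft_tsubst list_all_iff)

lemma wf1_fosubst1: "wft S t \<Longrightarrow> wf1 S (fosubst1 x t A) \<longleftrightarrow> wf1 S A"
  by (simp add: fosubst1_def wf1_subst1)

lemma wf2_subst2:
  assumes "wf2 S A" and "\<And>x. wft S (\<sigma> x)"
    and "\<And>X ts. list_all (wft S) ts \<Longrightarrow> wf2 S (\<tau> X ts)"
  shows "wf2 S (subst2 W \<sigma> \<tau> A)"
  using assms
  by (induction A arbitrary: W \<sigma> \<tau>)
    (auto simp: Let_def wft_tsubst list_all_iff upd_def split: var2.split)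

lemma wf2_fosubst2: "wf2 S A \<Longrightarrow> wft S t \<Longrightarrow> wf2 S (fosubst2 x t A)"
  by (simp add: fosubst2_def wf2_subst2)

lemma wf2_sorename: "wf2 S A \<Longrightarrow> wf2 S (sorename n X Y A)"
  by (simp add: sorename_def upd_def wf2_subst2)

lemma wf2_abstr:
  assumes "wf2 S G" and "list_all (wft S) ts"
  shows "wf2 S (abstr xs G ts)"
  unfolding abstr_def
  using assms
  by (intro wf2_subst2)
    (auto simp: list_all_iff split: option.split dest!: map_of_SomeD set_zip_rightD)

lemma wf2_sosubst: "wf2 S A \<Longrightarrow> wf2 S G \<Longrightarrow> wf2 S (sosubst X xs G A)"
  by (simp add: sosubst_def upd_def wf2_subst2 wf2_abstr)

text \<open>The value of a well-formed formula is closed under extension of the context. The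
  soundness proof obtains from here that the formulas of a subderivation are well-formed.\<close>

lemma nd1_wf: "nd1 S k \<Gamma> A \<Longrightarrow> (\<forall>F\<in>\<Gamma>. wf1 S F) \<and> wf1 S A"
  by (induction rule: nd1.induct) (auto simp: wf1_fosubst1)

text \<open>Set-theoretic core of a binder: \<open>h v\<close> is the set of variables put in place
  of \<open>v\<close>, \<open>a\<close> is the bound variable and \<open>b\<close> its fresh name
  outside \<open>W\<close>, so removing \<open>b\<close> afterwards amounts to leaving out
  \<open>a\<close> beforehand.\<close>

lemma UN_rename:
  assumes "h' a = {b}" and "\<And>v. v \<in> F \<Longrightarrow> v \<noteq> a \<Longrightarrow> h' v = h v"
    and "\<And>v. v \<in> F \<Longrightarrow> v \<noteq> a \<Longrightarrow> h v \<subseteq> W" and "b \<notin> W"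
  shows "(\<Union>v\<in>F. h' v) - {b} = (\<Union>v\<in>F - {a}. h v)"
proof -
  have "(\<Union>v\<in>F. h' v) - {b} = (\<Union>v\<in>F - {a}. h' v) - {b}"
    using assms(1) by auto
  also have "\<dots> = (\<Union>v\<in>F - {a}. h v) - {b}"
    using assms(2) by simp
  also have "\<dots> = (\<Union>v\<in>F - {a}. h v)"
    using assms(3,4) by fast
  finally show ?thesis .
qed

text \<open>Second-order variables are replaced by variables only. Such substitutions are stable
  under binders, where \<open>upd\<close> changes \<open>\<theta>\<close> at one arity and name, and
  they cover both quantifier clauses of the coding.\<close>

lemma free2_subst2:
  assumes "finite W"
    and "\<And>x. FO x \<in> free2 A \<Longrightarrow> FO ` fvt (\<sigma> x) \<subseteq> W"
    and "\<And>n X. SO n X \<in> free2 A \<Longrightarrow> SO n (\<theta> n X) \<in> W"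
  shows "free2 (subst2 W \<sigma> (\<lambda>X ts. Atom2 (\<theta> (length ts) X) ts) A) =
    (\<Union>v\<in>free2 A. case v of FO x \<Rightarrow> FO ` fvt (\<sigma> x) | SO n X \<Rightarrow> {SO n (\<theta> n X)})"
  using assms
proof (induction A arbitrary: W \<sigma> \<theta>)
  case (Atom2 X ts)
  have "fvts (map (tsubst \<sigma>) ts) = (\<Union>x\<in>fvts ts. fvt (\<sigma> x))"
  proof -
    have "fvt (tsubst \<sigma> t) = (\<Union>x\<in>fvt t. fvt (\<sigma> x))" for t
      by (induction t) auto
    then show ?thesis by (auto simp: fvts_def)
  qed
  then show ?case by auto
next
  case (Bin2 c A B)
  then show ?case by simp
next
  case (Q2 q v A)
  show ?case
  proof (cases v)
    case (FO x)
    define y where "y = variant (FO -` W) x"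
    have y: "FO y \<notin> W"
      using Q2.prems(1) by (simp add: y_def variant_FO_notin)
    have IH: "free2 (subst2 (insert (FO y) W) (\<sigma>(x := Var y)) (\<lambda>X ts. Atom2 (\<theta> (length ts) X) ts) A) =
      (\<Union>v\<in>free2 A. case v of FO z \<Rightarrow> FO ` fvt ((\<sigma>(x := Var y)) z) | SO n X \<Rightarrow> {SO n (\<theta> n X)})"
      using Q2.prems FO by (intro Q2.IH) auto
    have "free2 (subst2 (insert (FO y) W) (\<sigma>(x := Var y)) (\<lambda>X ts. Atom2 (\<theta> (length ts) X) ts) A) - {FO y} =
      (\<Union>v\<in>free2 A - {FO x}. case v of FO z \<Rightarrow> FO ` fvt (\<sigma> z) | SO n X \<Rightarrow> {SO n (\<theta> n X)})"
      unfolding IH using Q2.prems(2,3) FO y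
      by (intro UN_rename[where W = W]) (auto split: var2.split)
    then show ?thesis
      using FO by (simp add: Let_def y_def[symmetric])
  next
    case (SO n X)
    define Y where "Y = variant (SO n -` W) X"
    have Y: "SO n Y \<notin> W"
      using Q2.prems(1) by (simp add: Y_def variant_SO_notin)
    define \<theta>' where "\<theta>' = \<theta>(n := (\<theta> n)(X := Y))"
    have upd: "upd (\<lambda>X ts. Atom2 (\<theta> (length ts) X) ts) n X (Atom2 Y) =
        (\<lambda>X ts. Atom2 (\<theta>' (length ts) X) ts)"
      by (auto simp: upd_def \<theta>'_def fun_eq_iff)
    have IH: "free2 (subst2 (insert (SO n Y) W) \<sigma> (\<lambda>X ts. Atom2 (\<theta>' (length ts) X) ts) A) =
      (\<Union>v\<in>free2 A. case v of FO x \<Rightarrow> FO ` fvt (\<sigma> x) | SO m X \<Rightarrow> {SO m (\<theta>' m X)})"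
      using Q2.prems SO by (intro Q2.IH) (auto simp: \<theta>'_def)
    have "free2 (subst2 (insert (SO n Y) W) \<sigma> (\<lambda>X ts. Atom2 (\<theta>' (length ts) X) ts) A) - {SO n Y} =
      (\<Union>v\<in>free2 A - {SO n X}. case v of FO x \<Rightarrow> FO ` fvt (\<sigma> x) | SO m X \<Rightarrow> {SO m (\<theta> m X)})"
      unfolding IH
    proof (rule UN_rename[where W = W])
      fix w assume "w \<in> free2 A" "w \<noteq> SO n X"
      then have "w \<in> free2 (Q2 q v A)" using SO by simp
      then show "(case w of FO x \<Rightarrow> FO ` fvt (\<sigma> x) | SO m X \<Rightarrow> {SO m (\<theta> m X)}) \<subseteq> W"
        using Q2.prems(2,3) by (cases w) auto
    qed (use Y in \<open>auto simp: \<theta>'_def split: var2.split\<close>)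
    then show ?thesis
      using SO by (simp add: Let_def Y_def[symmetric] upd)
  qed
qed simp

lemma free2_fosubst2: "FO x \<noteq> v \<Longrightarrow> v \<in> free2 A \<Longrightarrow> v \<in> free2 (fosubst2 x t A)"
  unfolding fosubst2_def
  by (subst free2_subst2[where \<theta> = "\<lambda>_ X. X", simplified])
    (auto simp: finite_free2 finite_fvt split: var2.splits intro!: bexI[of _ v])

lemma free2_sorename:
  assumes "SO n X \<noteq> v" and "v \<in> free2 A"
  shows "v \<in> free2 (sorename n X Y A)"
proof -
  have upd: "upd Atom2 n X (Atom2 Y) =
      (\<lambda>Z ts. Atom2 ((\<lambda>m Z. if Z = X \<and> m = n then Y else Z) (length ts) Z) ts)"
    by (auto simp: upd_def fun_eq_iff)
  show ?thesis
    unfolding sorename_def upd using assms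
    by (subst free2_subst2) (auto simp: finite_free2 split: var2.splits intro!: bexI[of _ v])
qed


section \<open>Truth values\<close>

context
  fixes S :: "'f signature" and k :: logic
begin

definition ctx :: "'f fm2 set \<Rightarrow> bool" where
  "ctx \<Gamma> \<longleftrightarrow> finite \<Gamma> \<and> (\<forall>F\<in>\<Gamma>. wf2 S F)"

text \<open>
  Quantifying over all extensions of the context makes \<open>prov F\<close> monotone without a weakening lemma,
  which would require renaming eigenvariables inside derivations.
\<close>

definition prov :: "'f fm2 \<Rightarrow> 'f fm2 set set" where
  "prov F = {\<Gamma>. ctx \<Gamma> \<and> (\<forall>\<Delta>. ctx \<Delta> \<longrightarrow> \<Gamma> \<subseteq> \<Delta> \<longrightarrow> nd2 S k \<Delta> F)}"

definition himp :: "'f fm2 set set \<Rightarrow> 'f fm2 set set \<Rightarrow> 'f fm2 set set" where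
  "himp X Y = {\<Gamma>. ctx \<Gamma> \<and> (\<forall>\<Delta>. ctx \<Delta> \<longrightarrow> \<Gamma> \<subseteq> \<Delta> \<longrightarrow> \<Delta> \<in> X \<longrightarrow> \<Delta> \<in> Y)}"

text \<open>
  The impredicative form of the double-negation-like closure makes disjunction and existence sound:
  an element of \<open>hcl X\<close> proves whatever all elements of \<open>X\<close> above it prove.
\<close>

definition hcl :: "'f fm2 set set \<Rightarrow> 'f fm2 set set" where
  "hcl X = {\<Gamma>. ctx \<Gamma> \<and> (\<forall>D. wf2 S D \<longrightarrow> \<Gamma> \<in> himp (himp X (prov D)) (prov D))}"

definition closed_val :: "'f fm2 set set \<Rightarrow> bool" where
  "closed_val X \<longleftrightarrow> (\<forall>\<Gamma>\<in>X. ctx \<Gamma>) \<and>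
    (\<forall>\<Gamma> \<Delta>. \<Gamma> \<in> X \<longrightarrow> ctx \<Delta> \<longrightarrow> \<Gamma> \<subseteq> \<Delta> \<longrightarrow> \<Delta> \<in> X) \<and> hcl X \<subseteq> X"

primrec hbin :: "conn \<Rightarrow> 'f fm2 set set \<Rightarrow> 'f fm2 set set \<Rightarrow> 'f fm2 set set" where
  "hbin Imp X Y = himp X Y"
| "hbin Conj X Y = X \<inter> Y"
| "hbin Disj X Y = hcl (X \<union> Y)"

primrec hquant :: "quant \<Rightarrow> 'f fm2 set set set \<Rightarrow> 'f fm2 set set" where
  "hquant Forall V = \<Inter>V"
| "hquant Exists V = hcl (\<Union>V)"

section \<open>Laws of the truth values\<close>

lemma ctx_insert [simp]: "ctx (insert F \<Gamma>) \<longleftrightarrow> wf2 S F \<and> ctx \<Gamma>"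
  by (auto simp: ctx_def)

lemma prov_nd2: "\<Gamma> \<in> prov F \<Longrightarrow> nd2 S k \<Gamma> F"
  by (auto simp: prov_def)

lemma prov_ctx: "\<Gamma> \<in> prov F \<Longrightarrow> ctx \<Gamma>"
  by (auto simp: prov_def)

lemma prov_mono: "\<Gamma> \<in> prov F \<Longrightarrow> ctx \<Delta> \<Longrightarrow> \<Gamma> \<subseteq> \<Delta> \<Longrightarrow> \<Delta> \<in> prov F"
  unfolding prov_def by blast

lemma prov_assm: "ctx \<Gamma> \<Longrightarrow> F \<in> \<Gamma> \<Longrightarrow> \<Gamma> \<in> prov F"
  unfolding prov_def by (auto simp: ctx_def intro!: nd2.Assm)

lemma provI: "ctx \<Gamma> \<Longrightarrow> (\<And>\<Delta>. ctx \<Delta> \<Longrightarrow> \<Gamma> \<subseteq> \<Delta> \<Longrightarrow> nd2 S k \<Delta> F) \<Longrightarrow> \<Gamma> \<in> prov F"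
  by (simp add: prov_def)

lemma prov_ImpE:
  assumes "\<Gamma> \<in> prov (Bin2 Imp A B)" and "\<Gamma> \<in> prov A"
  shows "\<Gamma> \<in> prov B"
  using assms by (intro provI nd2.ImpE[of S k _ A B]) (auto simp: prov_def)

lemma himpI:
  "ctx \<Gamma> \<Longrightarrow> (\<And>\<Delta>. ctx \<Delta> \<Longrightarrow> \<Gamma> \<subseteq> \<Delta> \<Longrightarrow> \<Delta> \<in> X \<Longrightarrow> \<Delta> \<in> Y) \<Longrightarrow> \<Gamma> \<in> himp X Y"
  by (simp add: himp_def)

lemma himpD: "\<Gamma> \<in> himp X Y \<Longrightarrow> ctx \<Delta> \<Longrightarrow> \<Gamma> \<subseteq> \<Delta> \<Longrightarrow> \<Delta> \<in> X \<Longrightarrow> \<Delta> \<in> Y"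
  by (simp add: himp_def)

lemma himp_mono: "\<Gamma> \<in> himp X Y \<Longrightarrow> ctx \<Delta> \<Longrightarrow> \<Gamma> \<subseteq> \<Delta> \<Longrightarrow> \<Delta> \<in> himp X Y"
  unfolding himp_def by blast

lemma himp_ctx: "\<Gamma> \<in> himp X Y \<Longrightarrow> ctx \<Gamma>"
  by (simp add: himp_def)

lemma hclI:
  "ctx \<Gamma> \<Longrightarrow> (\<And>D \<Delta>. wf2 S D \<Longrightarrow> ctx \<Delta> \<Longrightarrow> \<Gamma> \<subseteq> \<Delta> \<Longrightarrow> \<Delta> \<in> himp X (prov D) \<Longrightarrow> \<Delta> \<in> prov D) \<Longrightarrow>
    \<Gamma> \<in> hcl X"
  by (auto simp: hcl_def intro!: himpI)

lemma hclD: "\<Gamma> \<in> hcl X \<Longrightarrow> wf2 S D \<Longrightarrow> ctx \<Delta> \<Longrightarrow> \<Gamma> \<subseteq> \<Delta> \<Longrightarrow> \<Delta> \<in> himp X (prov D) \<Longrightarrow> \<Delta> \<in> prov D"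
  by (auto simp: hcl_def intro: himpD)

lemma hcl_ctx: "\<Gamma> \<in> hcl X \<Longrightarrow> ctx \<Gamma>"
  by (simp add: hcl_def)

lemma hcl_mono: "\<Gamma> \<in> hcl X \<Longrightarrow> ctx \<Delta> \<Longrightarrow> \<Gamma> \<subseteq> \<Delta> \<Longrightarrow> \<Delta> \<in> hcl X"
  by (auto simp: hcl_def intro: himp_mono)

lemma hcl_incl: "ctx \<Gamma> \<Longrightarrow> (\<And>\<Delta>. ctx \<Delta> \<Longrightarrow> \<Gamma> \<subseteq> \<Delta> \<Longrightarrow> \<Delta> \<in> X) \<Longrightarrow> \<Gamma> \<in> hcl X"
  by (rule hclI) (auto dest: himpD)

text \<open>An implication from \<open>Y\<close> to \<open>prov D\<close> yields one from
  \<open>X\<close> to \<open>prov D\<close>, because elements of \<open>X\<close> lie in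
  \<open>hcl Y\<close>, which may be tested with the same \<open>D\<close>. So \<open>hcl\<close>
  behaves as a closure operator.\<close>

lemma hcl_least:
  assumes "\<Gamma> \<in> hcl X"
    and "\<And>\<Delta>. ctx \<Delta> \<Longrightarrow> \<Gamma> \<subseteq> \<Delta> \<Longrightarrow> \<Delta> \<in> X \<Longrightarrow> \<Delta> \<in> hcl Y"
  shows "\<Gamma> \<in> hcl Y"
proof (rule hclI)
  show "ctx \<Gamma>" using assms(1) by (rule hcl_ctx)
  fix D \<Delta>
  assume D: "wf2 S D" and \<Delta>: "ctx \<Delta>" "\<Gamma> \<subseteq> \<Delta>" and imp: "\<Delta> \<in> himp Y (prov D)"
  have "\<Delta> \<in> himp X (prov D)"
  proof (rule himpI)
    fix \<Delta>' assume \<Delta>': "ctx \<Delta>'" "\<Delta> \<subseteq> \<Delta>'" "\<Delta>' \<in> X"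
    then have "\<Delta>' \<in> hcl Y" using \<Delta> assms(2) by blast
    then show "\<Delta>' \<in> prov D"
      using D \<Delta>'(1) himp_mono[OF imp \<Delta>'(1,2)] by (blast intro: hclD)
  qed fact
  then show "\<Delta> \<in> prov D" using assms(1) D \<Delta> by (blast intro: hclD)
qed

lemma closed_val_ctx: "closed_val X \<Longrightarrow> \<Gamma> \<in> X \<Longrightarrow> ctx \<Gamma>"
  by (simp add: closed_val_def)

lemma closed_val_mono: "closed_val X \<Longrightarrow> \<Gamma> \<in> X \<Longrightarrow> ctx \<Delta> \<Longrightarrow> \<Gamma> \<subseteq> \<Delta> \<Longrightarrow> \<Delta> \<in> X"
  unfolding closed_val_def by blast

text \<open>The definition of \<open>hcl\<close> eliminates only into sets \<open>prov D\<close>.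
  Closedness of \<open>Z\<close> extends this to arbitrary truth values, as the elimination rules
  for disjunction and existence demand.\<close>

lemma hcl_elim:
  assumes "closed_val Z" and "\<Gamma> \<in> hcl X"
    and "\<And>\<Delta>. ctx \<Delta> \<Longrightarrow> \<Gamma> \<subseteq> \<Delta> \<Longrightarrow> \<Delta> \<in> X \<Longrightarrow> \<Delta> \<in> Z"
  shows "\<Gamma> \<in> Z"
proof -
  have "\<Gamma> \<in> hcl Z"
    using assms(2)
    by (rule hcl_least) (blast intro: hcl_incl assms(3) closed_val_mono[OF assms(1)])
  then show ?thesis using assms(1) by (auto simp: closed_val_def)
qed

lemma closed_val_hcl: "closed_val (hcl X)"
  unfolding closed_val_def by (blast intro: hcl_ctx hcl_mono hcl_least)

text \<open>The closure of \<open>prov F\<close> may be tested with \<open>D = F\<close>, where the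
  implication to be supplied is trivial.\<close>

lemma closed_val_prov:
  assumes "wf2 S F"
  shows "closed_val (prov F)"
  unfolding closed_val_def
proof (intro conjI subsetI)
  fix \<Gamma> assume \<Gamma>: "\<Gamma> \<in> hcl (prov F)"
  then have "ctx \<Gamma>" by (rule hcl_ctx)
  with \<Gamma> assms show "\<Gamma> \<in> prov F" by (blast intro: hclD himpI)
qed (blast intro: prov_ctx prov_mono)+

lemma closed_val_himp:
  assumes X: "closed_val X" and Y: "closed_val Y"
  shows "closed_val (himp X Y)"
  unfolding closed_val_def
proof (intro conjI subsetI)
  fix \<Gamma> assume \<Gamma>: "\<Gamma> \<in> hcl (himp X Y)"
  show "\<Gamma> \<in> himp X Y"
  proof (rule himpI)
    fix \<Delta> assume \<Delta>: "ctx \<Delta>" "\<Gamma> \<subseteq> \<Delta>" "\<Delta> \<in> X"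
    show "\<Delta> \<in> Y"
    proof (rule hcl_elim[OF Y])
      show "\<Delta> \<in> hcl (himp X Y)" using \<Gamma> \<Delta> by (blast intro: hcl_mono)
    qed (use X \<Delta> in \<open>blast intro: himpD closed_val_mono\<close>)
  qed (use \<Gamma> hcl_ctx in blast)
qed (blast intro: himp_ctx himp_mono)+

lemma closed_val_Inter:
  assumes "V \<noteq> {}" and "\<And>X. X \<in> V \<Longrightarrow> closed_val X"
  shows "closed_val (\<Inter>V)"
  unfolding closed_val_def
proof (intro conjI subsetI)
  fix \<Gamma> assume \<Gamma>: "\<Gamma> \<in> hcl (\<Inter>V)"
  show "\<Gamma> \<in> \<Inter>V"
  proof
    fix X assume "X \<in> V"
    with \<Gamma> assms(2) show "\<Gamma> \<in> X" by (auto intro: hcl_elim)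
  qed
qed (use assms in \<open>blast intro: closed_val_ctx closed_val_mono\<close>)+

lemma closed_val_hbin: "closed_val X \<Longrightarrow> closed_val Y \<Longrightarrow> closed_val (hbin c X Y)"
  using closed_val_Inter[of "{X, Y}"] by (cases c) (auto simp: closed_val_himp closed_val_hcl)

lemma closed_val_hquant: "V \<noteq> {} \<Longrightarrow> (\<And>X. X \<in> V \<Longrightarrow> closed_val X) \<Longrightarrow> closed_val (hquant q V)"
  by (cases q) (auto simp: closed_val_Inter closed_val_hcl)

text \<open>For a single \<open>prov D\<close> stability under double negation is reductio ad
  absurdum. It passes to every closed value because membership in \<open>hcl X\<close> is tested
  against the sets \<open>prov D\<close> only.\<close>

lemma closed_val_stable:
  assumes "k = Classical" and X: "closed_val X" and \<Gamma>: "\<Gamma> \<in> himp (himp X (prov Bot2)) (prov Bot2)"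
  shows "\<Gamma> \<in> X"
proof -
  have "\<Gamma> \<in> hcl X"
  proof (rule hclI)
    show "ctx \<Gamma>" using \<Gamma> by (rule himp_ctx)
    fix D \<Delta>
    assume D: "wf2 S D" and \<Delta>: "ctx \<Delta>" "\<Gamma> \<subseteq> \<Delta>" and imp: "\<Delta> \<in> himp X (prov D)"
    show "\<Delta> \<in> prov D"
    proof (rule provI)
      fix \<Delta>1 assume \<Delta>1: "ctx \<Delta>1" "\<Delta> \<subseteq> \<Delta>1"
      \<comment> \<open>Once the negation of \<open>D\<close> is assumed, the implication from
        \<open>X\<close> to \<open>D\<close> becomes one from \<open>X\<close> to falsum, to which
        the assumption on \<open>\<Gamma>\<close> applies.\<close>
      let ?N = "Bin2 Imp D Bot2"
      have ctx: "ctx (insert ?N \<Delta>1)" using \<Delta>1 D by simp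
      have "insert ?N \<Delta>1 \<in> himp X (prov Bot2)"
      proof (rule himpI)
        fix \<Delta>2 assume \<Delta>2: "ctx \<Delta>2" "insert ?N \<Delta>1 \<subseteq> \<Delta>2" "\<Delta>2 \<in> X"
        then have "\<Delta>2 \<in> prov D" using imp \<Delta>1 by (blast intro: himpD)
        moreover have "\<Delta>2 \<in> prov ?N" using \<Delta>2 by (blast intro: prov_assm)
        ultimately show "\<Delta>2 \<in> prov Bot2"
          by (rule prov_ImpE[rotated])
      qed fact
      then have "insert ?N \<Delta>1 \<in> prov Bot2"
        using \<Gamma> ctx \<Delta> \<Delta>1 by (blast intro: himpD)
      then show "nd2 S k \<Delta>1 D"
        by (rule nd2.RAA[OF assms(1) prov_nd2])
    qed fact
  qed
  with X show ?thesis by (auto simp: closed_val_def)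
qed

section \<open>Provability commutes with the logical operations\<close>

lemma himp_prov: "wf2 S A \<Longrightarrow> himp (prov A) (prov B) = prov (Bin2 Imp A B)"
proof (intro set_eqI iffI)
  fix \<Gamma> assume A: "wf2 S A" and \<Gamma>: "\<Gamma> \<in> himp (prov A) (prov B)"
  show "\<Gamma> \<in> prov (Bin2 Imp A B)"
  proof (rule provI)
    fix \<Delta> assume \<Delta>: "ctx \<Delta>" "\<Gamma> \<subseteq> \<Delta>"
    have "ctx (insert A \<Delta>)" using A \<Delta> by simp
    then have "insert A \<Delta> \<in> prov B" 
      using \<Delta> himpD[OF \<Gamma>, of "insert A \<Delta>"] by (blast intro: prov_assm)
    then show "nd2 S k \<Delta> (Bin2 Imp A B)" by (rule nd2.ImpI[OF prov_nd2])
  qed (use \<Gamma> himp_ctx in blast)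
next
  fix \<Gamma> assume "\<Gamma> \<in> prov (Bin2 Imp A B)"
  then show "\<Gamma> \<in> himp (prov A) (prov B)"
    by (auto intro!: himpI intro: prov_ctx prov_ImpE[OF prov_mono])
qed

lemma inter_prov: "prov A \<inter> prov B = prov (Bin2 Conj A B)"
  by (auto simp: prov_def intro: nd2.ConjI dest: nd2.ConjE1 nd2.ConjE2)

text \<open>Taking \<open>D\<close> to be the disjunction itself gives one inclusion; for the other,
  disjunction elimination with conclusion \<open>D\<close> is exactly the test in
  \<open>hcl\<close>.\<close>

lemma union_prov:
  assumes "wf2 S A" "wf2 S B"
  shows "hcl (prov A \<union> prov B) = prov (Bin2 Disj A B)"
proof (intro set_eqI iffI)
  fix \<Gamma> assume \<Gamma>: "\<Gamma> \<in> hcl (prov A \<union> prov B)"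
  then have "ctx \<Gamma>" by (rule hcl_ctx)
  moreover from this have "\<Gamma> \<in> himp (prov A \<union> prov B) (prov (Bin2 Disj A B))"
    using assms unfolding himp_def prov_def by (auto intro: nd2.DisjI1 nd2.DisjI2)
  ultimately show "\<Gamma> \<in> prov (Bin2 Disj A B)"
    using \<Gamma> assms by (auto intro: hclD)
next
  fix \<Gamma> assume \<Gamma>: "\<Gamma> \<in> prov (Bin2 Disj A B)"
  show "\<Gamma> \<in> hcl (prov A \<union> prov B)"
  proof (rule hclI)
    fix D \<Delta>
    assume D: "wf2 S D" and \<Delta>: "ctx \<Delta>" "\<Gamma> \<subseteq> \<Delta>" and imp: "\<Delta> \<in> himp (prov A \<union> prov B) (prov D)"
    show "\<Delta> \<in> prov D"
    proof (rule provI)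
      fix \<Delta>1 assume \<Delta>1: "ctx \<Delta>1" "\<Delta> \<subseteq> \<Delta>1"
      have "insert F \<Delta>1 \<in> prov D" if "F = A \<or> F = B" for F
      proof -
        have "ctx (insert F \<Delta>1)" using that assms \<Delta>1 by auto
        then show ?thesis
          using that \<Delta>1 by (intro himpD[OF imp]) (auto intro: prov_assm)
      qed
      moreover have "nd2 S k \<Delta>1 (Bin2 Disj A B)"
        using \<Gamma> \<Delta> \<Delta>1 by (blast intro: prov_nd2 prov_mono)
      ultimately show "nd2 S k \<Delta>1 D" by (metis nd2.DisjE prov_nd2)
    qed fact
  qed (use \<Gamma> prov_ctx in blast)
qed

lemma hbin_prov: "wf2 S A \<Longrightarrow> wf2 S B \<Longrightarrow> hbin c (prov A) (prov B) = prov (Bin2 c A B)"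
  by (cases c) (auto simp: himp_prov inter_prov union_prov)

text \<open>The abstract form serves both sorts of quantifiers: \<open>inst\<close> gives the
  instances, \<open>v y\<close> is an eigenvariable and \<open>j y\<close> the index of the instance
  formed with it. Finiteness of contexts provides a fresh \<open>y\<close>, so one generic instance
  settles universal introduction and existential elimination.\<close>

lemma hquant_prov:
  fixes I :: "'i set" and inst :: "'i \<Rightarrow> 'f fm2" and v :: "nat \<Rightarrow> var2" and j :: "nat \<Rightarrow> 'i"
  assumes wf: "wf2 S (Q2 Exists w A)" "\<And>i. i \<in> I \<Longrightarrow> wf2 S (inst i)"
    and v: "inj v" and j: "\<And>y. j y \<in> I"
    and AllI: "\<And>\<Gamma> y. nd2 S k \<Gamma> (inst (j y)) \<Longrightarrow>
      \<forall>F \<in> insert (Q2 Forall w A) \<Gamma>. v y \<notin> free2 F \<Longrightarrow> nd2 S k \<Gamma> (Q2 Forall w A)"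
    and AllE: "\<And>\<Gamma> i. \<Gamma> \<in> prov (Q2 Forall w A) \<Longrightarrow> i \<in> I \<Longrightarrow> \<Gamma> \<in> prov (inst i)"
    and ExI: "\<And>\<Gamma> i. \<Gamma> \<in> prov (inst i) \<Longrightarrow> i \<in> I \<Longrightarrow> \<Gamma> \<in> prov (Q2 Exists w A)"
    and ExE: "\<And>\<Gamma> y C. nd2 S k \<Gamma> (Q2 Exists w A) \<Longrightarrow> nd2 S k (insert (inst (j y)) \<Gamma>) C \<Longrightarrow>
      \<forall>F \<in> {Q2 Exists w A, C} \<union> \<Gamma>. v y \<notin> free2 F \<Longrightarrow> nd2 S k \<Gamma> C"
  shows "hquant q ((\<lambda>i. prov (inst i)) ` I) = prov (Q2 q w A)"
proof -
  have fresh: "\<exists>y. \<forall>F\<in>\<Gamma>. v y \<notin> free2 F" if "finite \<Gamma>" for \<Gamma> :: "'f fm2 set"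
    using ex_fresh_var2[OF _ v, of "\<Union> (free2 ` \<Gamma>)"] that finite_free2 by blast
  show ?thesis
  proof (cases q)
    case Forall
    have "\<Gamma> \<in> prov (Q2 Forall w A)" if "\<And>i. i \<in> I \<Longrightarrow> \<Gamma> \<in> prov (inst i)" for \<Gamma>
    proof (rule provI)
      show "ctx \<Gamma>" using that j prov_ctx by blast
      fix \<Delta> assume \<Delta>: "ctx \<Delta>" "\<Gamma> \<subseteq> \<Delta>"
      then obtain y where "\<forall>F \<in> insert (Q2 Forall w A) \<Delta>. v y \<notin> free2 F"
        using fresh[of "insert (Q2 Forall w A) \<Delta>"] by (auto simp: ctx_def)
      moreover have "nd2 S k \<Delta> (inst (j y))"
        using that[OF j] \<Delta> by (blast intro: prov_nd2 prov_mono)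
      ultimately show "nd2 S k \<Delta> (Q2 Forall w A)" by (rule AllI[rotated])
    qed
    with AllE Forall show ?thesis by auto
  next
    case Exists
    let ?U = "\<Union>i\<in>I. prov (inst i)"
    have "\<Gamma> \<in> prov (Q2 Exists w A)" if "\<Gamma> \<in> hcl ?U" for \<Gamma>
    proof -
      have ctx: "ctx \<Gamma>" using that by (rule hcl_ctx)
      then have "\<Gamma> \<in> himp ?U (prov (Q2 Exists w A))"
        using ExI by (auto intro: himpI)
      with ctx show ?thesis by (rule hclD[OF that wf(1) _ order_refl])
    qed
    moreover have "\<Gamma> \<in> hcl ?U" if \<Gamma>: "\<Gamma> \<in> prov (Q2 Exists w A)" for \<Gamma>
    proof (rule hclI)
      fix D \<Delta>
      assume D: "wf2 S D" and \<Delta>: "ctx \<Delta>" "\<Gamma> \<subseteq> \<Delta>" and imp: "\<Delta> \<in> himp ?U (prov D)"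
      show "\<Delta> \<in> prov D"
      proof (rule provI)
        fix \<Delta>1 assume \<Delta>1: "ctx \<Delta>1" "\<Delta> \<subseteq> \<Delta>1"
        then obtain y where y: "\<forall>F \<in> {Q2 Exists w A, D} \<union> \<Delta>1. v y \<notin> free2 F"
          using fresh[of "{Q2 Exists w A, D} \<union> \<Delta>1"] by (auto simp: ctx_def)
        have "ctx (insert (inst (j y)) \<Delta>1)" using wf(2) j \<Delta>1 by simp
        then have p: "insert (inst (j y)) \<Delta>1 \<in> prov D"
          using \<Delta>1 j by (intro himpD[OF imp]) (auto intro!: bexI[of _ "j y"] prov_assm)
        have e: "nd2 S k \<Delta>1 (Q2 Exists w A)"
          using \<Gamma> \<Delta> \<Delta>1 by (blast intro: prov_nd2 prov_mono)
        show "nd2 S k \<Delta>1 D" by (rule ExE[OF e prov_nd2[OF p] y])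
      qed fact
    qed (use \<Gamma> prov_ctx in blast)
    ultimately show ?thesis using Exists by auto
  qed
qed


section \<open>Interpretation of second-order formulas\<close>

definition updv :: "(svar \<Rightarrow> 'f tm list \<Rightarrow> 'f fm2 set set) \<Rightarrow> nat \<Rightarrow> svar \<Rightarrow>
    ('f tm list \<Rightarrow> 'f fm2 set set) \<Rightarrow> svar \<Rightarrow> 'f tm list \<Rightarrow> 'f fm2 set set" where
  "updv r n X P = (\<lambda>Z ts. if Z = X \<and> length ts = n then P ts else r Z ts)"

text \<open>Second-order quantifiers range over the values of variables, not over all predicates;
  this matches provability, since eigenvariables are variables. The price is that comprehension is
  not built in and has to be derived.\<close>

primrec sem2 :: "(fvar \<Rightarrow> 'f tm) \<Rightarrow> (svar \<Rightarrow> 'f tm list \<Rightarrow> 'f fm2 set set) \<Rightarrow> 'f fm2 \<Rightarrow>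
    'f fm2 set set" where
  "sem2 s r Bot2 = prov Bot2"
| "sem2 s r (Atom2 X ts) = r X (map (tsubst s) ts)"
| "sem2 s r (Bin2 c A B) = hbin c (sem2 s r A) (sem2 s r B)"
| "sem2 s r (Q2 q v A) = hquant q
    (case v of
      FO x \<Rightarrow> (\<lambda>t. sem2 (s(x := t)) r A) ` {t. wft S t}
    | SO n X \<Rightarrow> range (\<lambda>Y. sem2 s (updv r n X (\<lambda>ts. prov (Atom2 Y ts))) A))"

definition agree :: "var2 set \<Rightarrow> (fvar \<Rightarrow> 'f tm) \<Rightarrow> (svar \<Rightarrow> 'f tm list \<Rightarrow> 'f fm2 set set) \<Rightarrow>
    (fvar \<Rightarrow> 'f tm) \<Rightarrow> (svar \<Rightarrow> 'f tm list \<Rightarrow> 'f fm2 set set) \<Rightarrow> bool" where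
  "agree W s r s' r' \<longleftrightarrow> (\<forall>x. FO x \<in> W \<longrightarrow> s x = s' x) \<and>
    (\<forall>n X. SO n X \<in> W \<longrightarrow> (\<forall>ts. length ts = n \<longrightarrow> r X ts = r' X ts))"

lemma agreeI:
  "(\<And>x. FO x \<in> W \<Longrightarrow> s x = s' x) \<Longrightarrow>
    (\<And>X ts. SO (length ts) X \<in> W \<Longrightarrow> r X ts = r' X ts) \<Longrightarrow> agree W s r s' r'"
  by (simp add: agree_def)

lemma agree_FO: "agree W s r s' r' \<Longrightarrow> FO x \<in> W \<Longrightarrow> s x = s' x"
  by (simp add: agree_def)

lemma agree_SO: "agree W s r s' r' \<Longrightarrow> SO (length ts) X \<in> W \<Longrightarrow> r X ts = r' X ts"
  by (simp add: agree_def)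

lemma agree_updv:
  assumes "agree (W - {SO n X}) s r s' r'"
  shows "agree W s (updv r n X P) s' (updv r' n X P)"
proof (rule agreeI)
  show "s x = s' x" if "FO x \<in> W" for x
    using agree_FO[OF assms] that by simp
  fix Z and ts :: "'f tm list"
  assume Z: "SO (length ts) Z \<in> W"
  show "updv r n X P Z ts = updv r' n X P Z ts"
  proof (cases "Z = X \<and> length ts = n")
    case False
    with Z have "r Z ts = r' Z ts" by (intro agree_SO[OF assms]) auto
    with False show ?thesis by (auto simp: updv_def)
  qed (simp add: updv_def)
qed

definition atoms :: "(nat \<Rightarrow> svar \<Rightarrow> svar) \<Rightarrow> svar \<Rightarrow> 'f tm list \<Rightarrow> 'f fm2 set set" where
  "atoms \<theta> = (\<lambda>X ts. prov (Atom2 (\<theta> (length ts) X) ts))"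

text \<open>Valuations \<open>atoms \<theta>\<close> are stable under the update made by a
  second-order quantifier, so a mixed prefix of quantifiers is handled by varying the term
  assignment and \<open>\<theta>\<close> alone.\<close>

lemma updv_atoms:
  "updv (atoms \<theta>) n X (\<lambda>ts. prov (Atom2 Y ts)) = atoms (\<theta>(n := (\<theta> n)(X := Y)))"
  by (auto simp: updv_def atoms_def fun_eq_iff)

lemma sem2_cong: "agree (free2 A) s r s' r' \<Longrightarrow> sem2 s r A = sem2 s' r' A"
proof (induction A arbitrary: s r s' r')
  case (Atom2 X ts)
  have "map (tsubst s) ts = map (tsubst s') ts"
    using Atom2 by (auto simp: agree_def fvts_def intro!: tsubst_cong)
  moreover have "r X (map (tsubst s') ts) = r' X (map (tsubst s') ts)"
    using Atom2 by (simp add: agree_def)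
  ultimately show ?case by (simp only: sem2.simps)
next
  case (Bin2 c A B)
  then have "sem2 s r A = sem2 s' r' A" "sem2 s r B = sem2 s' r' B"
    by (intro Bin2.IH; simp add: agree_def)+
  then show ?case by simp
next
  case (Q2 q v A)
  show ?case
  proof (cases v)
    case (FO x)
    then have "sem2 (s(x := t)) r A = sem2 (s'(x := t)) r' A" for t
      using Q2.prems by (intro Q2.IH) (auto simp: agree_def)
    with FO show ?thesis by simp
  next
    case (SO n X)
    then have "sem2 s (updv r n X P) A = sem2 s' (updv r' n X P) A" for P
      using Q2.prems by (intro Q2.IH agree_updv) simp
    with SO show ?thesis by simp
  qed
qed simp

text \<open>Below a binder the valuations change at the bound variable, which \<open>subst2\<close>
  has moved outside \<open>W\<close>. The third assumption speaks of all valuations agreeing on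
  \<open>W\<close> so that it survives this change. Since \<open>R\<close> gives the denotation of
  \<open>\<tau>\<close> semantically, renaming and abstraction are covered alike.\<close>

lemma sem2_subst2:
  assumes "finite W"
    and "\<And>x. FO x \<in> free2 A \<Longrightarrow> FO ` fvt (\<sigma> x) \<subseteq> W"
    and "\<And>n X s' r' ts. SO n X \<in> free2 A \<Longrightarrow> agree W s r s' r' \<Longrightarrow> length ts = n \<Longrightarrow>
      sem2 s' r' (\<tau> X ts) = R X (map (tsubst s') ts)"
  shows "sem2 s r (subst2 W \<sigma> \<tau> A) = sem2 (\<lambda>x. tsubst s (\<sigma> x)) R A"
  using assms
proof (induction A arbitrary: W \<sigma> \<tau> s r R)
  case (Atom2 X ts)
  have "sem2 s r (\<tau> X (map (tsubst \<sigma>) ts)) = R X (map (tsubst s) (map (tsubst \<sigma>) ts))"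
    using Atom2.prems(3)[of "length ts" X s r "map (tsubst \<sigma>) ts"] by (simp add: agree_def)
  then show ?case by (simp add: tsubst_tsubst comp_def)
next
  case (Bin2 c A B)
  have "sem2 s r (subst2 W \<sigma> \<tau> A) = sem2 (\<lambda>x. tsubst s (\<sigma> x)) R A"
    by (rule Bin2.IH(1)[OF Bin2.prems]) auto
  moreover have "sem2 s r (subst2 W \<sigma> \<tau> B) = sem2 (\<lambda>x. tsubst s (\<sigma> x)) R B"
    by (rule Bin2.IH(2)[OF Bin2.prems]) auto
  ultimately show ?case by simp
next
  case (Q2 q v A)
  show ?case
  proof (cases v)
    case (FO x)
    define y where "y = variant (FO -` W) x"
    have y: "FO y \<notin> W"
      using Q2.prems(1) by (simp add: y_def variant_FO_notin)
    have "sem2 (s(y := t)) r (subst2 (insert (FO y) W) (\<sigma>(x := Var y)) \<tau> A) =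
        sem2 ((\<lambda>z. tsubst s (\<sigma> z))(x := t)) R A" for t
    proof -
      have "sem2 (s(y := t)) r (subst2 (insert (FO y) W) (\<sigma>(x := Var y)) \<tau> A) =
          sem2 (\<lambda>z. tsubst (s(y := t)) ((\<sigma>(x := Var y)) z)) R A"
      proof (rule Q2.IH)
        fix n X s' r' and ts :: "'f tm list"
        assume "SO n X \<in> free2 A" "agree (insert (FO y) W) (s(y := t)) r s' r'" "length ts = n"
        moreover from this y have "agree W s r s' r'"
          unfolding agree_def by (metis fun_upd_other insertI2)
        ultimately show "sem2 s' r' (\<tau> X ts) = R X (map (tsubst s') ts)"
          using FO Q2.prems(3) by simp
      qed (use FO Q2.prems in auto)
      also have "\<dots> = sem2 ((\<lambda>z. tsubst s (\<sigma> z))(x := t)) R A"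
      proof (rule sem2_cong)
        have "tsubst (s(y := t)) (\<sigma> z) = tsubst s (\<sigma> z)" if "FO z \<in> free2 A" "z \<noteq> x" for z
          using that y FO Q2.prems(2)[of z] by (intro tsubst_cong) auto
        then show "agree (free2 A) (\<lambda>z. tsubst (s(y := t)) ((\<sigma>(x := Var y)) z)) R
            ((\<lambda>z. tsubst s (\<sigma> z))(x := t)) R"
          by (auto simp: agree_def)
      qed
      finally show ?thesis .
    qed
    with FO show ?thesis by (simp add: Let_def y_def[symmetric])
  next
    case (SO n X)
    define Y where "Y = variant (SO n -` W) X"
    have Y: "SO n Y \<notin> W"
      using Q2.prems(1) by (simp add: Y_def variant_SO_notin)
    have "sem2 s (updv r n Y (\<lambda>ts. prov (Atom2 Z ts)))
          (subst2 (insert (SO n Y) W) \<sigma> (upd \<tau> n X (Atom2 Y)) A) =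
        sem2 (\<lambda>x. tsubst s (\<sigma> x)) (updv R n X (\<lambda>ts. prov (Atom2 Z ts))) A" for Z
    proof (rule Q2.IH)
      fix m V s' r' and ts :: "'f tm list"
      assume V: "SO m V \<in> free2 A" and len: "length ts = m"
        and agree: "agree (insert (SO n Y) W) s (updv r n Y (\<lambda>ts. prov (Atom2 Z ts))) s' r'"
      show "sem2 s' r' (upd \<tau> n X (Atom2 Y) V ts) =
          updv R n X (\<lambda>ts. prov (Atom2 Z ts)) V (map (tsubst s') ts)"
      proof (cases "V = X \<and> m = n")
        case True
        have "r' Y (map (tsubst s') ts) = prov (Atom2 Z (map (tsubst s') ts))"
          using agree True len by (simp add: agree_def updv_def)
        with True len show ?thesis by (simp add: upd_def updv_def)
      next
        case False
        have "agree W s r s' r'"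
          using agree Y unfolding agree_def updv_def by (metis insertI2)
        with False V len SO Q2.prems(3)[of m V s' r' ts] show ?thesis
          by (auto simp: upd_def updv_def)
      qed
    qed (use SO Q2.prems in auto)
    with SO show ?thesis by (simp add: Let_def Y_def[symmetric])
  qed
qed simp

lemma sem2_rename:
  assumes "finite W"
    and "\<And>x. FO x \<in> free2 A \<Longrightarrow> FO ` fvt (\<sigma> x) \<subseteq> W"
    and "\<And>n X. SO n X \<in> free2 A \<Longrightarrow> SO n (\<theta> n X) \<in> W"
  shows "sem2 s r (subst2 W \<sigma> (\<lambda>X ts. Atom2 (\<theta> (length ts) X) ts) A) =
    sem2 (\<lambda>x. tsubst s (\<sigma> x)) (\<lambda>X ts. r (\<theta> (length ts) X) ts) A"
proof (rule sem2_subst2)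
  fix n X s' r' and ts :: "'f tm list"
  assume "SO n X \<in> free2 A" "agree W s r s' r'" "length ts = n"
  then show "sem2 s' r' (Atom2 (\<theta> (length ts) X) ts) =
      r (\<theta> (length (map (tsubst s') ts)) X) (map (tsubst s') ts)"
    using assms(3)[of n X] agree_SO[of W s r s' r' "map (tsubst s') ts" "\<theta> n X"] by simp
qed (use assms in auto)

lemma sem2_fosubst2: "sem2 s r (fosubst2 x t A) = sem2 (s(x := tsubst s t)) r A"
proof -
  have "sem2 s r (fosubst2 x t A) = sem2 (\<lambda>z. tsubst s ((Var(x := t)) z)) r A"
    unfolding fosubst2_def
    by (rule sem2_subst2) (auto simp: finite_free2 finite_fvt agree_def)
  also have "(\<lambda>z. tsubst s ((Var(x := t)) z)) = s(x := tsubst s t)"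
    by auto
  finally show ?thesis .
qed

lemma sem2_sorename: "sem2 s r (sorename n X Y A) = sem2 s (updv r n X (r Y)) A"
proof -
  have "sem2 s r (sorename n X Y A) = sem2 (\<lambda>x. tsubst s (Var x)) (updv r n X (r Y)) A"
    unfolding sorename_def
    by (rule sem2_subst2) (auto simp: finite_free2 agree_def upd_def updv_def)
  then show ?thesis by simp
qed

definition upds :: "(fvar \<Rightarrow> 'f tm) \<Rightarrow> fvar list \<Rightarrow> 'f tm list \<Rightarrow> fvar \<Rightarrow> 'f tm" where
  "upds s xs ts = (\<lambda>x. case map_of (zip xs ts) x of Some t \<Rightarrow> t | None \<Rightarrow> s x)"

lemma sem2_abstr: "sem2 s r (abstr xs G ts) = sem2 (upds s xs (map (tsubst s) ts)) r G"
proof -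
  have "sem2 s r (abstr xs G ts) =
      sem2 (\<lambda>x. tsubst s (case map_of (zip xs ts) x of Some t \<Rightarrow> t | None \<Rightarrow> Var x)) r G"
    unfolding abstr_def
  proof (rule sem2_subst2)
    fix x assume "FO x \<in> free2 G"
    then show "FO ` fvt (case map_of (zip xs ts) x of None \<Rightarrow> Var x | Some t \<Rightarrow> t)
        \<subseteq> free2 G \<union> FO ` fvts ts"
      by (auto simp: fvts_def split: option.split dest!: map_of_SomeD set_zip_rightD)
  qed (auto simp: finite_free2 finite_fvts agree_def)
  also have "(\<lambda>x. tsubst s (case map_of (zip xs ts) x of Some t \<Rightarrow> t | None \<Rightarrow> Var x)) =
      upds s xs (map (tsubst s) ts)"
    by (auto simp: upds_def fun_eq_iff zip_map2 map_of_map split: option.split)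
  finally show ?thesis .
qed

lemma sem2_sosubst:
  "sem2 s r (sosubst X xs G A) =
    sem2 s (updv r (length xs) X (\<lambda>ts. sem2 (upds s xs ts) r G)) A"
proof -
  have "sem2 s r (sosubst X xs G A) =
    sem2 (\<lambda>x. tsubst s (Var x)) (updv r (length xs) X (\<lambda>ts. sem2 (upds s xs ts) r G)) A"
    unfolding sosubst_def
  proof (rule sem2_subst2)
    fix n Z s' r' and ts :: "'f tm list"
    assume "SO n Z \<in> free2 A" "length ts = n" and agree: "agree (free2 A \<union> free2 G) s r s' r'"
    \<comment> \<open>Bound variables of \<open>A\<close> avoid the free variables of
      \<open>G\<close>, so the abstraction may be evaluated at the outer valuations wherever it is
      inserted.\<close>
    moreover have "sem2 (upds s' xs ts') r' G = sem2 (upds s xs ts') r G" for ts'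
      using agree by (intro sem2_cong) (auto simp: agree_def upds_def split: option.split)
    ultimately show "sem2 s' r' (upd Atom2 (length xs) X (abstr xs G) Z ts) =
        updv r (length xs) X (\<lambda>ts. sem2 (upds s xs ts) r G) Z (map (tsubst s') ts)"
      by (auto simp: upd_def updv_def sem2_abstr agree_def)
  qed (auto simp: finite_free2)
  then show ?thesis by simp
qed

lemma upds_map_self: "distinct xs \<Longrightarrow> length ts = length xs \<Longrightarrow> map (upds s xs ts) xs = ts"
  by (intro nth_equalityI) (auto simp: upds_def map_of_zip_nth)

abbreviation idv :: "nat \<Rightarrow> svar \<Rightarrow> svar" where
  "idv \<equiv> \<lambda>_ X. X"

lemma prov_AllE: "\<Gamma> \<in> prov (Q2 Forall (FO x) A) \<Longrightarrow> wft S t \<Longrightarrow> \<Gamma> \<in> prov (fosubst2 x t A)"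
  by (auto simp: prov_def intro: nd2.AllE)

lemma prov_ExI:
  "\<Gamma> \<in> prov (fosubst2 x t A) \<Longrightarrow> wft S t \<Longrightarrow> wf2 S A \<Longrightarrow> \<Gamma> \<in> prov (Q2 Exists (FO x) A)"
  by (auto simp: prov_def intro: nd2.ExI)

lemma prov_AllE2:
  "\<Gamma> \<in> prov (Q2 Forall (SO (length xs) X) A) \<Longrightarrow> distinct xs \<Longrightarrow> wf2 S G \<Longrightarrow>
    \<Gamma> \<in> prov (sosubst X xs G A)"
  by (auto simp: prov_def intro: nd2.AllE2)

lemma prov_ExI2:
  "\<Gamma> \<in> prov (sosubst X xs G A) \<Longrightarrow> distinct xs \<Longrightarrow> wf2 S G \<Longrightarrow> wf2 S A \<Longrightarrow>
    \<Gamma> \<in> prov (Q2 Exists (SO (length xs) X) A)"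
  by (auto simp: prov_def intro: nd2.ExI2)

text \<open>An atomic abstraction replaces atoms by atoms, so such an instance stays within reach of
  an induction on depth.\<close>

lemma depth_sosubst_atom: "depth (sosubst X xs (Atom2 Y ts) A) = depth A"
  by (simp add: sosubst_def abstr_def upd_def depth_subst2)

text \<open>
  The instance of a quantified formula is evaluated by the semantic substitution lemmas, so no
  syntactic fact on alpha-equivalence or on composition of substitutions is needed.
\<close>

lemma sem2_Var_idv: "wf2 S A \<Longrightarrow> sem2 Var (atoms idv) A = prov A"
proof (induction "depth A" arbitrary: A rule: less_induct)
  case less
  show ?case
  proof (cases A)
    case Bot2
    then show ?thesis by simp
  next
    case (Atom2 X ts)
    then show ?thesis by (simp add: atoms_def)
  next
    case (Bin2 c B C)
    then have "sem2 Var (atoms idv) B = prov B" "sem2 Var (atoms idv) C = prov C"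
      using less.prems by (auto intro!: less.hyps)
    with Bin2 less.prems show ?thesis by (simp add: hbin_prov)
  next
    case (Q2 q v B)
    have wf: "wf2 S B" using Q2 less.prems by simp
    show ?thesis
    proof (cases v)
      case (FO x)
      have inst: "sem2 (Var(x := t)) (atoms idv) B = prov (fosubst2 x t B)" if "wft S t" for t
        using less.hyps[of "fosubst2 x t B"] that wf Q2
        by (simp add: wf2_fosubst2 sem2_fosubst2)
      have "hquant q ((\<lambda>t. prov (fosubst2 x t B)) ` {t. wft S t}) = prov (Q2 q (FO x) B)"
      proof (rule hquant_prov[where v = FO and j = Var])
        show "nd2 S k \<Gamma> C" if "nd2 S k \<Gamma> (Q2 Exists (FO x) B)"
          "nd2 S k (insert (fosubst2 x (Var y) B) \<Gamma>) C"
          "\<forall>F\<in>{Q2 Exists (FO x) B, C} \<union> \<Gamma>. FO y \<notin> free2 F" for \<Gamma> y C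
          using that by (rule nd2.ExE)
      qed (use wf in \<open>auto simp: inj_def wf2_fosubst2 intro: nd2.AllI prov_AllE prov_ExI\<close>)
      with Q2 FO inst show ?thesis by simp
    next
      case (SO n X)
      define xs where "xs = [0..<n]"
      have xs: "distinct xs" "length xs = n" by (auto simp: xs_def)
      have inst: "sem2 Var (updv (atoms idv) n X (\<lambda>ts. prov (Atom2 Y ts))) B =
          prov (sorename n X Y B)" for Y
      proof -
        have "updv (atoms idv) n X (\<lambda>ts. prov (Atom2 Y ts)) =
            updv (atoms idv) n X (atoms idv Y)"
          by (simp add: atoms_def)
        then show ?thesis
          using less.hyps[of "sorename n X Y B"] wf Q2 by (simp add: wf2_sorename sem2_sorename)
      qed
      \<comment> \<open>Universal elimination and existential introduction use abstractions, the
        other two rules use renaming. For the abstraction of a single atom both instances have the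
        same value, hence the same provability set.\<close>
      have abstr: "prov (sosubst X xs (Atom2 Y (map Var xs)) B) = prov (sorename n X Y B)" for Y
      proof -
        let ?G = "Atom2 Y (map Var xs) :: 'f fm2"
        have G: "wf2 S ?G" by (simp add: list_all_iff)
        have "updv (atoms idv) (length xs) X (\<lambda>ts. sem2 (upds Var xs ts) (atoms idv) ?G) =
            updv (atoms idv) n X (\<lambda>ts. prov (Atom2 Y ts))"
          using xs by (auto simp: updv_def fun_eq_iff atoms_def comp_def upds_map_self)
        then show ?thesis
          using less.hyps[of "sosubst X xs ?G B"] wf Q2 G inst[of Y]
          by (simp add: wf2_sosubst sem2_sosubst depth_sosubst_atom)
      qed
      have "hquant q ((\<lambda>Y. prov (sorename n X Y B)) ` UNIV) = prov (Q2 q (SO n X) B)"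
      proof (rule hquant_prov[where v = "SO n" and j = "\<lambda>Y. Y"])
        show "nd2 S k \<Gamma> C" if "nd2 S k \<Gamma> (Q2 Exists (SO n X) B)"
          "nd2 S k (insert (sorename n X Y B) \<Gamma>) C"
          "\<forall>F\<in>{Q2 Exists (SO n X) B, C} \<union> \<Gamma>. SO n Y \<notin> free2 F" for \<Gamma> Y C
          using that by (rule nd2.ExE2)
        show "\<Gamma> \<in> prov (sorename n X Y B)" if "\<Gamma> \<in> prov (Q2 Forall (SO n X) B)" for \<Gamma> Y
          using that xs prov_AllE2[of \<Gamma> xs X B "Atom2 Y (map Var xs)"]
          by (simp add: abstr list_all_iff)
        show "\<Gamma> \<in> prov (Q2 Exists (SO n X) B)" if "\<Gamma> \<in> prov (sorename n X Y B)" for \<Gamma> Y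
          using that xs wf prov_ExI2[of \<Gamma> X xs "Atom2 Y (map Var xs)" B]
          by (simp add: abstr list_all_iff)
      qed (use wf in \<open>auto simp: inj_def wf2_sorename intro: nd2.AllI2\<close>)
      with Q2 SO inst show ?thesis by simp
    qed
  qed
qed


section \<open>Comprehension\<close>

text \<open>The predicate defined by \<open>G\<close> need not be the value of a variable, so it is
  no direct witness in the model. Substituting \<open>s\<close> and \<open>\<theta>\<close> into the
  existential formula turns its value into a set \<open>prov\<close>, and there \<open>ExI2\<close>
  accepts the abstraction of \<open>G\<close>.\<close>

lemma comprehension:
  assumes wf: "wf2 S C" "wf2 S G" and s: "\<And>x. wft S (s x)" and ys: "distinct ys"
  shows "sem2 s (updv (atoms \<theta>) (length ys) X (\<lambda>ts. sem2 (upds Var ys ts) (atoms idv) G)) C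
    \<subseteq> sem2 s (atoms \<theta>) (Q2 Exists (SO (length ys) X) C)"
proof -
  let ?n = "length ys" and ?P = "\<lambda>ts. sem2 (upds Var ys ts) (atoms idv) G"
  define E where "E = Q2 Exists (SO ?n X) C"
  \<comment> \<open>\<open>W\<close> collects the free variables of \<open>E\<close> after
    substitution of \<open>s\<close> and \<open>\<theta>\<close>. The name \<open>Z\<close> is the
    one that \<open>subst2\<close> itself picks for the bound variable.\<close>
  define W where "W = (\<Union>v\<in>free2 E. case v of FO x \<Rightarrow> FO ` fvt (s x) | SO m Z \<Rightarrow> {SO m (\<theta> m Z)})"
  define Z where "Z = variant (SO ?n -` W) X"
  have finW: "finite W"
    by (auto simp: W_def finite_free2 finite_fvt split: var2.split)
  then have Z: "SO ?n Z \<notin> W"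
    by (simp add: Z_def variant_SO_notin)
  have W_FO: "FO ` fvt (s x) \<subseteq> W" if "FO x \<in> free2 E" for x
    using that by (force simp: W_def)
  have W_SO: "SO m (\<theta> m V) \<in> W" if "SO m V \<in> free2 E" for m V
    using that by (force simp: W_def)
  define \<tau> :: "svar \<Rightarrow> 'f tm list \<Rightarrow> 'f fm2" where "\<tau> = (\<lambda>X ts. Atom2 (\<theta> (length ts) X) ts)"
  define C' where "C' = subst2 (insert (SO ?n Z) W) s (upd \<tau> ?n X (Atom2 Z)) C"
  have E': "subst2 W s \<tau> E = Q2 Exists (SO ?n Z) C'"
    by (simp add: E_def C'_def Z_def Let_def)
  have wfC': "wf2 S C'"
    unfolding C'_def using wf s by (intro wf2_subst2) (auto simp: upd_def \<tau>_def)
  have semC: "sem2 s (updv (atoms \<theta>) ?n X ?P) C = prov (sosubst Z ys G C')"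
  proof -
    have "prov (sosubst Z ys G C') = sem2 Var (atoms idv) (sosubst Z ys G C')"
      using wfC' wf by (simp add: sem2_Var_idv wf2_sosubst)
    also have "\<dots> = sem2 Var (updv (atoms idv) ?n Z ?P) C'"
      by (simp add: sem2_sosubst)
    also have "\<dots> = sem2 (\<lambda>x. tsubst Var (s x)) (updv (atoms \<theta>) ?n X ?P) C"
      unfolding C'_def
    proof (rule sem2_subst2)
      fix m V s' r' and ts :: "'f tm list"
      assume V: "SO m V \<in> free2 C" and len: "length ts = m"
        and agree: "agree (insert (SO ?n Z) W) Var (updv (atoms idv) ?n Z ?P) s' r'"
      show "sem2 s' r' (upd \<tau> ?n X (Atom2 Z) V ts) = updv (atoms \<theta>) ?n X ?P V (map (tsubst s') ts)"
      proof (cases "V = X \<and> m = ?n")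
        case True
        have "r' Z (map (tsubst s') ts) = ?P (map (tsubst s') ts)"
          using agree True len by (simp add: agree_def updv_def)
        with True len show ?thesis by (simp add: upd_def updv_def)
      next
        case False
        then have in_W: "SO m (\<theta> m V) \<in> W" using V by (intro W_SO) (auto simp: E_def)
        \<comment> \<open>Freshness of \<open>Z\<close> keeps the renamed free variables apart from
          the bound one, so the update at \<open>Z\<close> does not touch their values.\<close>
        then have ne: "\<not> (\<theta> m V = Z \<and> m = ?n)" using Z by auto
        have "r' (\<theta> m V) ts' = prov (Atom2 (\<theta> m V) ts')" if ts': "length ts' = m" for ts'
        proof -
          have "updv (atoms idv) ?n Z ?P (\<theta> m V) ts' = r' (\<theta> m V) ts'"
            using in_W ts' by (intro agree_SO[OF agree]) simp
          moreover have "updv (atoms idv) ?n Z ?P (\<theta> m V) ts' = atoms idv (\<theta> m V) ts'"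
            unfolding updv_def using ne ts' by (intro if_not_P) blast
          ultimately show ?thesis by (simp add: atoms_def)
        qed
        with False len show ?thesis by (auto simp: upd_def updv_def \<tau>_def atoms_def)
      qed
    qed (use finW W_FO in \<open>auto simp: E_def\<close>)
    finally show ?thesis by simp
  qed
  have "prov (Q2 Exists (SO ?n Z) C') = sem2 Var (atoms idv) (subst2 W s \<tau> E)"
    unfolding E' using wfC' by (subst sem2_Var_idv) auto
  also have "\<dots> = sem2 s (atoms \<theta>) E"
    unfolding \<tau>_def using finW W_FO W_SO by (subst sem2_rename) (auto simp: atoms_def)
  finally show ?thesis
    using prov_ExI2[of _ Z ys G C'] ys wf wfC' by (auto simp: semC E_def)
qed

lemma sem2_foldr_Forall:
  assumes "\<And>s' \<theta>'. (\<And>x. wft S (s' x)) \<Longrightarrow> \<Gamma> \<in> sem2 s' (atoms \<theta>') B" and "\<And>x. wft S (s x)"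
  shows "\<Gamma> \<in> sem2 s (atoms \<theta>) (foldr (Q2 Forall) \<chi>s B)"
  using assms(2)
  by (induction \<chi>s arbitrary: s \<theta>) (auto simp: updv_atoms assms(1) split: var2.split)

text \<open>The valuation \<open>r\<close> is arbitrary because it will interpret \<open>X\<close>
  by a predicate that need not come from a variable.\<close>

lemma sem2_foldr_Forall_FO:
  assumes "\<And>s'. (\<And>x. wft S (s' x)) \<Longrightarrow> (\<And>x. x \<notin> set xs \<Longrightarrow> s' x = s x) \<Longrightarrow> \<Gamma> \<in> sem2 s' r B"
    and "\<And>x. wft S (s x)"
  shows "\<Gamma> \<in> sem2 s r (foldr (\<lambda>x. Q2 Forall (FO x)) xs B)"
  using assms
proof (induction xs arbitrary: s)
  case (Cons x xs)
  have "\<Gamma> \<in> sem2 (s(x := t)) r (foldr (\<lambda>x. Q2 Forall (FO x)) xs B)" if "wft S t" for t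
    using that Cons.prems by (intro Cons.IH) auto
  then show ?case by auto
qed simp

lemma sem2_Iff2: "ctx \<Gamma> \<Longrightarrow> sem2 s r F = sem2 s r G \<Longrightarrow> \<Gamma> \<in> sem2 s r (Iff2 F G)"
  by (auto simp: Iff2_def himp_def)

lemma ex_fresh_list:
  "finite (V :: nat set) \<Longrightarrow> \<exists>ys. distinct ys \<and> length ys = n \<and> set ys \<inter> V = {}"
proof (induction n)
  case (Suc n)
  then obtain ys where ys: "distinct ys" "length ys = n" "set ys \<inter> V = {}" by blast
  obtain y where "y \<notin> set ys \<union> V"
    using Suc.prems by (metis List.finite_set ex_new_if_finite finite_UnI infinite_UNIV_nat)
  with ys show ?case by (intro exI[of _ "y # ys"]) auto
qed auto

text \<open>Evaluating the universal prefix leaves parameters \<open>s\<close> and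
  \<open>\<theta>\<close>. Substituting them into \<open>G\<close> produces an actual formula
  \<open>G'\<close>, whose abstraction is the witness; under it both sides of the equivalence have
  equal values.\<close>

lemma SC2_valid:
  assumes F: "F \<in> SC2 S" and ctx: "ctx \<Gamma>"
  shows "\<Gamma> \<in> sem2 Var (atoms idv) F"
proof -
  obtain \<chi>s X xs G where F: "F = foldr (Q2 Forall) \<chi>s (Q2 Exists (SO (length xs) X)
      (foldr (\<lambda>x. Q2 Forall (FO x)) xs (Iff2 G (Atom2 X (map Var xs)))))"
    and wfG: "wf2 S G" and X: "SO (length xs) X \<notin> free2 G"
    using F by (auto simp: SC2_def)
  define C where "C = foldr (\<lambda>x. Q2 Forall (FO x)) xs (Iff2 G (Atom2 X (map Var xs)))"
  have wfC: "wf2 S C"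
  proof -
    have "wf2 S (foldr (\<lambda>x. Q2 Forall (FO x)) xs' B) = wf2 S B" for xs' B
      by (induction xs') auto
    then show ?thesis using wfG by (simp add: C_def Iff2_def list_all_iff)
  qed
  have "\<Gamma> \<in> sem2 s (atoms \<theta>) (Q2 Exists (SO (length xs) X) C)" if s: "\<And>x. wft S (s x)" for s \<theta>
  proof -
    \<comment> \<open>\<open>xs\<close> may contain repetitions, whereas abstraction needs distinct variables.\<close>
    define V where "V = (\<Union>v\<in>free2 G. case v of FO x \<Rightarrow> fvt (s x) | SO _ _ \<Rightarrow> {})"
    have finV: "finite V"
      by (auto simp: V_def finite_free2 finite_fvt split: var2.split)
    then obtain ys where ys: "distinct ys" "length ys = length xs" "set ys \<inter> V = {}"
      using ex_fresh_list by blast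
    \<comment> \<open>Variables in \<open>xs\<close> go to the fresh \<open>ys\<close>, all others
      to their value under \<open>s\<close>. For a repeated variable the first position counts,
      which is harmless as \<open>map s' xs\<close> has equal entries at all its positions.\<close>
    define \<sigma> where "\<sigma> = upds s xs (map Var ys)"
    define W where "W = FO ` (V \<union> set ys) \<union> (\<Union>v\<in>free2 G. case v of FO x \<Rightarrow> {} | SO m Z \<Rightarrow> {SO m (\<theta> m Z)})"
    define G' where "G' = subst2 W \<sigma> (\<lambda>X ts. Atom2 (\<theta> (length ts) X) ts) G"
    have finW: "finite W"
      using finV by (auto simp: W_def finite_free2 split: var2.split)
    have \<sigma>_Some: "\<exists>i<length xs. xs ! i = x \<and> \<sigma> x = Var (ys ! i)" if x: "x \<in> set xs" for x
    proof -
      obtain t :: "'f tm" where t: "map_of (zip xs (map Var ys)) x = Some t"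
        using x ys(2) by (metis length_map map_of_zip_is_Some)
      then have "(x, t) \<in> set (zip xs (map Var ys))" by (rule map_of_SomeD)
      then show ?thesis using t ys(2) by (auto simp: \<sigma>_def upds_def set_zip)
    qed
    have \<sigma>_None: "\<sigma> x = s x" if "x \<notin> set xs" for x
    proof -
      have "map_of (zip xs (map Var ys :: 'f tm list)) x = None"
        using that ys(2) by (simp add: map_of_zip_is_None)
      then show ?thesis by (simp add: \<sigma>_def upds_def)
    qed
    have \<sigma>_wf: "wft S (\<sigma> x)" for x
      using s \<sigma>_None \<sigma>_Some by (cases "x \<in> set xs") fastforce+
    have \<sigma>_W: "FO ` fvt (\<sigma> x) \<subseteq> W" if "FO x \<in> free2 G" for x
    proof (cases "x \<in> set xs")
      case True
      then show ?thesis using \<sigma>_Some[OF True] ys(2) by (auto simp: W_def)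
    next
      case False
      then have "fvt (\<sigma> x) \<subseteq> V" using that by (force simp: \<sigma>_None V_def)
      then show ?thesis by (auto simp: W_def)
    qed
    have W_SO: "SO m (\<theta> m Z) \<in> W" if "SO m Z \<in> free2 G" for m Z
      using that by (force simp: W_def)
    have wfG': "wf2 S G'"
      unfolding G'_def using wfG \<sigma>_wf by (intro wf2_subst2) auto
    define P where "P = (\<lambda>ts. sem2 (upds Var ys ts) (atoms idv) G')"
    have P: "P (map s' xs) = sem2 s' (updv (atoms \<theta>) (length xs) X P) G"
      if s': "\<And>x. x \<notin> set xs \<Longrightarrow> s' x = s x" for s'
    proof -
      let ?u = "upds Var ys (map s' xs)"
      have "P (map s' xs) = sem2 (\<lambda>x. tsubst ?u (\<sigma> x)) (atoms \<theta>) G"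
        unfolding P_def G'_def using finW \<sigma>_W W_SO by (subst sem2_rename) (auto simp: atoms_def)
      also have "\<dots> = sem2 s' (updv (atoms \<theta>) (length xs) X P) G"
      proof (rule sem2_cong)
        have "tsubst ?u (\<sigma> x) = s' x" if x: "FO x \<in> free2 G" for x
        proof (cases "x \<in> set xs")
          case True
          with \<sigma>_Some obtain i where "i < length xs" "xs ! i = x" "\<sigma> x = Var (ys ! i)" by blast
          then show ?thesis using ys by (simp add: upds_def map_of_zip_nth)
        next
          case False
          \<comment> \<open>The parameter terms contain none of the \<open>ys\<close>, so inserting
            arguments for \<open>ys\<close> leaves them unchanged.\<close>
          have "?u y = Var y" if "y \<in> fvt (s x)" for y
          proof -
            have "y \<in> V" using that x by (force simp: V_def)
            then have "map_of (zip ys (map s' xs)) y = None"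
              using ys by (subst map_of_zip_is_None) auto
            then show ?thesis by (simp add: upds_def)
          qed
          then have "tsubst ?u (s x) = tsubst Var (s x)" by (rule tsubst_cong)
          then show ?thesis using False s' by (simp add: \<sigma>_None)
        qed
        \<comment> \<open>Since \<open>X\<close> is not free in \<open>G\<close>, reading
          \<open>X\<close> as \<open>P\<close> does not alter the value of \<open>G\<close>.\<close>
        then show "agree (free2 G) (\<lambda>x. tsubst ?u (\<sigma> x)) (atoms \<theta>) s' (updv (atoms \<theta>) (length xs) X P)"
          using X by (auto simp: agree_def updv_def)
      qed
      finally show ?thesis .
    qed
    have "\<Gamma> \<in> sem2 s (updv (atoms \<theta>) (length xs) X P) C"
      unfolding C_def
    proof (rule sem2_foldr_Forall_FO)
      fix s' assume "\<And>x. x \<notin> set xs \<Longrightarrow> s' x = s x"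
      then have "P (map s' xs) = sem2 s' (updv (atoms \<theta>) (length xs) X P) G" by (rule P)
      then show "\<Gamma> \<in> sem2 s' (updv (atoms \<theta>) (length xs) X P) (Iff2 G (Atom2 X (map Var xs)))"
        using ctx by (intro sem2_Iff2) (auto simp: comp_def updv_def)
    qed (rule s)
    moreover have "sem2 s (updv (atoms \<theta>) (length xs) X P) C
        \<subseteq> sem2 s (atoms \<theta>) (Q2 Exists (SO (length xs) X) C)"
      unfolding P_def ys(2)[symmetric] by (rule comprehension[OF wfC wfG' s ys(1)])
    ultimately show ?thesis by (rule rev_subsetD)
  qed
  then show ?thesis
    unfolding F C_def[symmetric] by (intro sem2_foldr_Forall) auto
qed


section \<open>Interpretation of first-order formulas\<close>

text \<open>
  An individual is a term together with one second-order variable of each arity. A compound term has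
  no second-order reading, and the second-order variables of its value are arbitrary.
\<close>

type_synonym 'g indiv = "'g tm \<times> (nat \<Rightarrow> svar)"

definition evt :: "(fvar \<Rightarrow> 'f indiv) \<Rightarrow> 'f tm \<Rightarrow> 'f indiv" where
  "evt \<rho> t = (tsubst (fst \<circ> \<rho>) t, case t of Var x \<Rightarrow> snd (\<rho> x) | Fn _ _ \<Rightarrow> (\<lambda>_. 0))"

primrec sem1 :: "(fvar \<Rightarrow> 'f indiv) \<Rightarrow> 'f fm1 \<Rightarrow> 'f fm2 set set" where
  "sem1 \<rho> Bot1 = prov Bot2"
| "sem1 \<rho> (Ap t ts) = prov (Atom2 (snd (evt \<rho> t) (length ts)) (map (tsubst (fst \<circ> \<rho>)) ts))"
| "sem1 \<rho> (Bin1 c A B) = hbin c (sem1 \<rho> A) (sem1 \<rho> B)"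
| "sem1 \<rho> (Q1 q x A) = hquant q ((\<lambda>d. sem1 (\<rho>(x := d)) A) ` {d. wft S (fst d)})"

lemma evt_Var [simp]: "evt \<rho> (Var x) = \<rho> x"
  by (simp add: evt_def)

lemma evt_cong: "(\<And>x. x \<in> fvt t \<Longrightarrow> \<rho> x = \<rho>' x) \<Longrightarrow> evt \<rho> t = evt \<rho>' t"
  using tsubst_cong[of t "fst \<circ> \<rho>" "fst \<circ> \<rho>'"] by (cases t) (simp_all add: evt_def)

text \<open>Composition survives the default for compound terms: for a variable both sides are the
  value of \<open>\<sigma> x\<close>, and a compound term stays compound under substitution,
  receiving the same constant default.\<close>

lemma evt_tsubst: "evt \<rho> (tsubst \<sigma> t) = evt (\<lambda>x. evt \<rho> (\<sigma> x)) t"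
  by (cases t) (auto simp: evt_def tsubst_tsubst comp_def)

lemma fst_evt: "fst (evt \<rho> t) = tsubst (fst \<circ> \<rho>) t"
  by (simp add: evt_def)

lemma wft_evt: "(\<And>x. wft S (fst (\<rho> x))) \<Longrightarrow> wft S t \<Longrightarrow> wft S (fst (evt \<rho> t))"
  by (simp add: evt_def wft_tsubst)

lemma sem1_cong: "(\<And>x. x \<in> free1 A \<Longrightarrow> \<rho> x = \<rho>' x) \<Longrightarrow> sem1 \<rho> A = sem1 \<rho>' A"
proof (induction A arbitrary: \<rho> \<rho>')
  case (Ap t ts)
  have "evt \<rho> t = evt \<rho>' t" using Ap by (intro evt_cong) auto
  moreover have "map (tsubst (fst \<circ> \<rho>)) ts = map (tsubst (fst \<circ> \<rho>')) ts"
    using Ap by (auto simp: fvts_def intro!: tsubst_cong arg_cong[where f = fst] Ap)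
  ultimately show ?case by (simp only: sem1.simps)
next
  case (Bin1 c A B)
  have "sem1 \<rho> A = sem1 \<rho>' A"
    by (rule Bin1.IH(1)) (simp add: Bin1.prems)
  moreover have "sem1 \<rho> B = sem1 \<rho>' B"
    by (rule Bin1.IH(2)) (simp add: Bin1.prems)
  ultimately show ?case by simp
next
  case (Q1 q x A)
  have "sem1 (\<rho>(x := d)) A = sem1 (\<rho>'(x := d)) A" for d
    using Q1.prems by (intro Q1.IH) auto
  then show ?case by simp
qed simp

lemma sem1_subst1:
  assumes "finite W" and "\<And>x. x \<in> free1 A \<Longrightarrow> fvt (\<sigma> x) \<subseteq> W"
  shows "sem1 \<rho> (subst1 W \<sigma> A) = sem1 (\<lambda>x. evt \<rho> (\<sigma> x)) A"
  using assms
proof (induction A arbitrary: W \<sigma> \<rho>)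
  case (Ap t ts)
  show ?case by (simp add: evt_tsubst tsubst_tsubst comp_def fst_evt)
next
  case (Bin1 c A B)
  then show ?case by simp
next
  case (Q1 q x A)
  define y where "y = variant W x"
  have y: "y \<notin> W" using Q1.prems(1) by (simp add: y_def variant_notin)
  have "sem1 (\<rho>(y := d)) (subst1 (insert y W) (\<sigma>(x := Var y)) A) =
      sem1 ((\<lambda>z. evt \<rho> (\<sigma> z))(x := d)) A" for d
  proof -
    have "sem1 (\<rho>(y := d)) (subst1 (insert y W) (\<sigma>(x := Var y)) A) =
        sem1 (\<lambda>z. evt (\<rho>(y := d)) ((\<sigma>(x := Var y)) z)) A"
      using Q1.prems by (intro Q1.IH) auto
    also have "\<dots> = sem1 ((\<lambda>z. evt \<rho> (\<sigma> z))(x := d)) A"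
    proof (rule sem1_cong)
      fix z assume z: "z \<in> free1 A"
      have "evt (\<rho>(y := d)) (\<sigma> z) = evt \<rho> (\<sigma> z)" if "z \<noteq> x"
        using that z y Q1.prems(2)[of z] by (intro evt_cong) auto
      then show "evt (\<rho>(y := d)) ((\<sigma>(x := Var y)) z) = ((\<lambda>z. evt \<rho> (\<sigma> z))(x := d)) z" by simp
    qed
    finally show ?thesis .
  qed
  then show ?case by (simp add: Let_def y_def[symmetric])
qed simp

lemma sem1_fosubst1: "sem1 \<rho> (fosubst1 x t A) = sem1 (\<rho>(x := evt \<rho> t)) A"
proof -
  have "sem1 \<rho> (fosubst1 x t A) = sem1 (\<lambda>z. evt \<rho> ((Var(x := t)) z)) A"
    unfolding fosubst1_def by (rule sem1_subst1) (auto simp: finite_free1 finite_fvt)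
  also have "(\<lambda>z. evt \<rho> ((Var(x := t)) z)) = \<rho>(x := evt \<rho> t)" by auto
  finally show ?thesis .
qed

lemma closed_val_sem1:
  "wf1 S A \<Longrightarrow> (\<And>x. wft S (fst (\<rho> x))) \<Longrightarrow> closed_val (sem1 \<rho> A)"
proof (induction A arbitrary: \<rho>)
  case (Ap t ts)
  then show ?case by (auto simp: list_all_iff wft_tsubst intro!: closed_val_prov)
next
  case (Q1 q x A)
  have "closed_val (sem1 (\<rho>(x := d)) A)" if "wft S (fst d)" for d
    using that Q1.prems by (intro Q1.IH) auto
  moreover have "{d :: 'f indiv. wft S (fst d)} \<noteq> {}"
    using wft.simps(1) by (metis (mono_tags) empty_iff fst_conv mem_Collect_eq)
  ultimately show ?case
    by (simp only: sem1.simps) (intro closed_val_hquant, auto)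
qed (auto simp: closed_val_prov closed_val_hbin)

lemma sem1_mono:
  "wf1 S A \<Longrightarrow> (\<And>x. wft S (fst (\<rho> x))) \<Longrightarrow> \<Gamma> \<in> sem1 \<rho> A \<Longrightarrow> ctx \<Delta> \<Longrightarrow> \<Gamma> \<subseteq> \<Delta> \<Longrightarrow>
    \<Delta> \<in> sem1 \<rho> A"
  by (rule closed_val_mono[OF closed_val_sem1])

text \<open>Environment and context both vary in the induction: eigenvariables receive arbitrary
  individuals, and discharged assumptions lead to larger contexts, where monotonicity keeps the
  remaining assumptions valid.\<close>

lemma sem1_sound:
  assumes "nd1 S k \<Gamma> A" and "\<And>x. wft S (fst (\<rho> x))" and "ctx \<Delta>"
    and "\<And>F. F \<in> \<Gamma> \<Longrightarrow> \<Delta> \<in> sem1 \<rho> F"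
  shows "\<Delta> \<in> sem1 \<rho> A"
  using assms
proof (induction arbitrary: \<rho> \<Delta> rule: nd1.induct)
  case (Assm \<Gamma> A)
  then show ?case by blast
next
  case (BotE \<Gamma> A)
  have bot: "\<Delta> \<in> prov Bot2" using BotE.IH[of \<rho> \<Delta>, OF BotE.prems] by simp
  \<comment> \<open>\<open>hcl {}\<close> is the least closed value, and it contains every context
    that proves falsum.\<close>
  have "\<Delta> \<in> hcl {}"
  proof (rule hclI[OF BotE.prems(2)])
    fix D \<Delta>' assume D: "wf2 S D" and \<Delta>': "ctx \<Delta>'" "\<Delta> \<subseteq> \<Delta>'"
    show "\<Delta>' \<in> prov D"
    proof (rule provI[OF \<Delta>'(1)])
      fix \<Delta>'' assume "ctx \<Delta>''" "\<Delta>' \<subseteq> \<Delta>''"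
      then have "\<Delta>'' \<in> prov Bot2" using \<Delta>'(2) by (intro prov_mono[OF bot]) auto
      then show "nd2 S k \<Delta>'' D" by (rule nd2.BotE[OF prov_nd2 D])
    qed
  qed
  then show ?case
    using closed_val_sem1[OF BotE.hyps(2) BotE.prems(1)] by (auto intro: hcl_elim)
next
  case (RAA A \<Gamma>)
  have wf: "\<forall>F\<in>\<Gamma>. wf1 S F" "wf1 S A" using nd1_wf[OF RAA.hyps(2)] by auto
  show ?case
  proof (rule closed_val_stable[OF RAA.hyps(1) closed_val_sem1[OF wf(2) RAA.prems(1)]])
    show "\<Delta> \<in> himp (himp (sem1 \<rho> A) (prov Bot2)) (prov Bot2)"
    proof (rule himpI[OF RAA.prems(2)])
      fix \<Delta>' assume \<Delta>': "ctx \<Delta>'" "\<Delta> \<subseteq> \<Delta>'" "\<Delta>' \<in> himp (sem1 \<rho> A) (prov Bot2)"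
      have "\<Delta>' \<in> sem1 \<rho> F" if "F \<in> \<Gamma>" for F
        using that wf by (intro sem1_mono[OF _ RAA.prems(1,3) \<Delta>'(1,2)]) auto
      then have "\<Delta>' \<in> sem1 \<rho> F" if "F \<in> insert (Bin1 Imp A Bot1) \<Gamma>" for F
        using that \<Delta>'(3) by auto
      then have "\<Delta>' \<in> sem1 \<rho> Bot1" by (rule RAA.IH[of \<rho> \<Delta>', OF RAA.prems(1) \<Delta>'(1)])
      then show "\<Delta>' \<in> prov Bot2" by simp
    qed
  qed
next
  case (ImpI A \<Gamma> B)
  have wf: "\<forall>F\<in>\<Gamma>. wf1 S F" using nd1_wf[OF ImpI.hyps] by auto
  have "\<Delta>' \<in> sem1 \<rho> B" if \<Delta>': "ctx \<Delta>'" "\<Delta> \<subseteq> \<Delta>'" "\<Delta>' \<in> sem1 \<rho> A" for \<Delta>'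
  proof (rule ImpI.IH[of \<rho> \<Delta>', OF ImpI.prems(1) \<Delta>'(1)])
    have "\<Delta>' \<in> sem1 \<rho> F" if "F \<in> \<Gamma>" for F
      using that wf by (intro sem1_mono[OF _ ImpI.prems(1,3) \<Delta>'(1,2)]) auto
    then show "\<Delta>' \<in> sem1 \<rho> F" if "F \<in> insert A \<Gamma>" for F
      using that \<Delta>'(3) by auto
  qed
  then show ?case using ImpI.prems(2) by (auto intro: himpI)
next
  case (ImpE \<Gamma> A B)
  then have "\<Delta> \<in> himp (sem1 \<rho> A) (sem1 \<rho> B)" "\<Delta> \<in> sem1 \<rho> A" by auto
  then show ?case using ImpE.prems(2) by (auto intro: himpD)
next
  case (ConjI \<Gamma> A B)
  then show ?case by simp
next
  case (ConjE1 \<Gamma> A B)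
  then have "\<Delta> \<in> sem1 \<rho> (Bin1 Conj A B)" by blast
  then show ?case by simp
next
  case (ConjE2 \<Gamma> A B)
  then have "\<Delta> \<in> sem1 \<rho> (Bin1 Conj A B)" by blast
  then show ?case by simp
next
  case (DisjI1 \<Gamma> A B)
  then have "\<Delta> \<in> sem1 \<rho> A" by blast
  moreover have "closed_val (sem1 \<rho> A)"
    using DisjI1.prems nd1_wf[OF DisjI1.hyps(1)] by (intro closed_val_sem1) auto
  ultimately show ?case using DisjI1.prems(2) by (auto intro!: hcl_incl dest: closed_val_mono)
next
  case (DisjI2 \<Gamma> B A)
  then have "\<Delta> \<in> sem1 \<rho> B" by blast
  moreover have "closed_val (sem1 \<rho> B)"
    using DisjI2.prems nd1_wf[OF DisjI2.hyps(1)] by (intro closed_val_sem1) auto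
  ultimately show ?case using DisjI2.prems(2) by (auto intro!: hcl_incl dest: closed_val_mono)
next
  case (DisjE \<Gamma> A B C)
  have wf: "\<forall>F\<in>\<Gamma>. wf1 S F" "wf1 S C" using nd1_wf[OF DisjE.hyps(2)] by auto
  have disj: "\<Delta> \<in> hcl (sem1 \<rho> A \<union> sem1 \<rho> B)"
    using DisjE.IH(1)[of \<rho> \<Delta>, OF DisjE.prems] by simp
  show ?case
  proof (rule hcl_elim[OF closed_val_sem1[OF wf(2) DisjE.prems(1)] disj])
    fix \<Delta>' assume \<Delta>': "ctx \<Delta>'" "\<Delta> \<subseteq> \<Delta>'" "\<Delta>' \<in> sem1 \<rho> A \<union> sem1 \<rho> B"
    have "\<Delta>' \<in> sem1 \<rho> F" if "F \<in> \<Gamma>" for F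
      using that wf by (intro sem1_mono[OF _ DisjE.prems(1,3) \<Delta>'(1,2)]) auto
    then show "\<Delta>' \<in> sem1 \<rho> C"
      using \<Delta>' DisjE.IH(2,3)[of \<rho> \<Delta>', OF DisjE.prems(1) \<Delta>'(1)] by auto
  qed
next
  case (AllI \<Gamma> x y A)
  have "\<Delta> \<in> sem1 (\<rho>(x := d)) A" if d: "wft S (fst d)" for d
  proof -
    have "\<Delta> \<in> sem1 (\<rho>(y := d)) F" if "F \<in> \<Gamma>" for F
    proof -
      have "sem1 (\<rho>(y := d)) F = sem1 \<rho> F"
        using that AllI.hyps(2) by (intro sem1_cong) auto
      then show ?thesis using that AllI.prems(3) by simp
    qed
    moreover have "wft S (fst ((\<rho>(y := d)) z))" for z
      using AllI.prems(1) d by simp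
    ultimately have "\<Delta> \<in> sem1 (\<rho>(y := d)) (fosubst1 x (Var y) A)"
      using AllI.prems(2) by (intro AllI.IH[of "\<rho>(y := d)" \<Delta>])
    also have "\<dots> = sem1 (\<rho>(x := d)) A"
      unfolding sem1_fosubst1 using AllI.hyps(2) by (intro sem1_cong) auto
    finally show ?thesis .
  qed
  then show ?case by simp
next
  case (AllE \<Gamma> x A t)
  then have "\<Delta> \<in> sem1 \<rho> (Q1 Forall x A)" by blast
  moreover have "wft S (fst (evt \<rho> t))" using AllE by (intro wft_evt) auto
  ultimately have "\<Delta> \<in> sem1 (\<rho>(x := evt \<rho> t)) A"
    by (simp only: sem1.simps hquant.simps) blast
  then show ?case by (simp add: sem1_fosubst1)
next
  case (ExI \<Gamma> x t A)
  have wf: "wft S (fst (evt \<rho> t))" using ExI by (intro wft_evt) auto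
  then have "closed_val (sem1 (\<rho>(x := evt \<rho> t)) A)"
    using ExI.prems ExI.hyps by (intro closed_val_sem1) auto
  moreover have "\<Delta> \<in> sem1 (\<rho>(x := evt \<rho> t)) A"
    using ExI.IH[of \<rho> \<Delta>, OF ExI.prems] by (simp add: sem1_fosubst1)
  ultimately have "\<Delta>' \<in> sem1 (\<rho>(x := evt \<rho> t)) A" if "ctx \<Delta>'" "\<Delta> \<subseteq> \<Delta>'" for \<Delta>'
    using that by (rule closed_val_mono)
  then have "\<Delta>' \<in> (\<Union>d\<in>{d. wft S (fst d)}. sem1 (\<rho>(x := d)) A)"
    if "ctx \<Delta>'" "\<Delta> \<subseteq> \<Delta>'" for \<Delta>'
    using that wf by blast
  with ExI.prems(2) show ?case by (simp only: sem1.simps hquant.simps) (rule hcl_incl)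
next
  case (ExE \<Gamma> x A y C)
  have wf: "\<forall>F\<in>\<Gamma>. wf1 S F" "wf1 S C" using nd1_wf[OF ExE.hyps(2)] by auto
  have ex: "\<Delta> \<in> hcl (\<Union>d\<in>{d. wft S (fst d)}. sem1 (\<rho>(x := d)) A)"
    using ExE.IH(1)[of \<rho> \<Delta>, OF ExE.prems] by simp
  show ?case
  proof (rule hcl_elim[OF closed_val_sem1[OF wf(2) ExE.prems(1)] ex])
    fix \<Delta>' assume \<Delta>': "ctx \<Delta>'" "\<Delta> \<subseteq> \<Delta>'"
      and "\<Delta>' \<in> (\<Union>d\<in>{d. wft S (fst d)}. sem1 (\<rho>(x := d)) A)"
    then obtain d where d: "wft S (fst d)" "\<Delta>' \<in> sem1 (\<rho>(x := d)) A" by auto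
    have "sem1 (\<rho>(y := d)) (fosubst1 x (Var y) A) = sem1 (\<rho>(x := d)) A"
      unfolding sem1_fosubst1 using ExE.hyps(3) by (intro sem1_cong) auto
    moreover have "\<Delta>' \<in> sem1 (\<rho>(y := d)) F" if "F \<in> \<Gamma>" for F
    proof -
      have "sem1 (\<rho>(y := d)) F = sem1 \<rho> F"
        using that ExE.hyps(3) by (intro sem1_cong) auto
      moreover have "\<Delta>' \<in> sem1 \<rho> F"
        using that wf by (intro sem1_mono[OF _ ExE.prems(1,3) \<Delta>'(1,2)]) auto
      ultimately show ?thesis by simp
    qed
    ultimately have F: "\<Delta>' \<in> sem1 (\<rho>(y := d)) F" if "F \<in> insert (fosubst1 x (Var y) A) \<Gamma>" for F
      using that d(2) by auto
    have "wft S (fst ((\<rho>(y := d)) z))" for z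
      using ExE.prems(1) d(1) by simp
    then have "\<Delta>' \<in> sem1 (\<rho>(y := d)) C"
      using F \<Delta>'(1) by (intro ExE.IH(2)[of "\<rho>(y := d)" \<Delta>'])
    also have "\<dots> = sem1 \<rho> C"
      using ExE.hyps(3) by (intro sem1_cong) auto
    finally show "\<Delta>' \<in> sem1 \<rho> C" .
  qed
qed


section \<open>The coding\<close>

text \<open>Freshness in the coding refers to \<open>star B\<close>, agreement of valuations to
  \<open>B\<close>; this inclusion connects them. Free variables other than the bound one survive
  the renaming, and the new bound name, fresh for \<open>star B\<close>, is the code of none of
  them.\<close>

lemma free1_star:
  assumes "is_coding \<phi> star"
  shows "(\<forall>x. FO x \<in> free2 A \<longrightarrow> x \<in> free1 (star A)) \<and>
    (\<forall>n X. SO n X \<in> free2 A \<longrightarrow> \<phi> n X \<in> free1 (star A))"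
proof (induction "depth A" arbitrary: A rule: less_induct)
  case less
  note code = assms[unfolded is_coding_def]
  show ?case
  proof (cases A)
    case Bot2
    then show ?thesis by simp
  next
    case (Atom2 X ts)
    then show ?thesis using code by auto
  next
    case (Bin2 c B C)
    then show ?thesis using code less[of B] less[of C] by auto
  next
    case (Q2 q v B)
    have B: "FO x \<in> free2 B \<Longrightarrow> x \<in> free1 (star B)"
      "SO n X \<in> free2 B \<Longrightarrow> \<phi> n X \<in> free1 (star B)" for x n X
      using less[of B] Q2 by auto
    obtain y B' where y: "y \<notin> free1 (star B)" and A: "star A = Q1 q y (star B')"
      and B': "depth B' = depth B" "\<And>w. w \<in> free2 A \<Longrightarrow> w \<in> free2 B'"
    proof (cases v)
      case (FO x)
      with Q2 code obtain y where "y \<notin> free1 (star B)" "star A = Q1 q y (star (fosubst2 x (Var y) B))"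
        by metis
      with Q2 FO show ?thesis
        by (intro that[of y "fosubst2 x (Var y) B"]) (auto intro: free2_fosubst2)
    next
      case (SO n X)
      with Q2 code obtain y Y where "y \<notin> free1 (star B)" "star A = Q1 q y (star (sorename n X Y B))"
        by metis
      with Q2 SO show ?thesis
        by (intro that[of y "sorename n X Y B"]) (auto intro: free2_sorename)
    qed
    show ?thesis
      using less[of B'] B y A B' Q2 by auto
  qed
qed

definition so_env :: "(nat \<Rightarrow> svar \<Rightarrow> fvar) \<Rightarrow> (fvar \<Rightarrow> 'f indiv) \<Rightarrow> nat \<Rightarrow> svar \<Rightarrow> svar" where
  "so_env \<phi> \<rho> = (\<lambda>n X. snd (\<rho> (\<phi> n X)) n)"

lemma image_factor: "f ` I = J \<Longrightarrow> (\<lambda>x. g (f x)) ` I = g ` J"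
  by auto

text \<open>A quantifier of the coded formula ranges over whole individuals, but by freshness of its
  variable only one component matters. Projecting onto that component gives exactly the range of the
  original quantifier.\<close>

lemma sem1_star:
  assumes "is_coding \<phi> star"
  shows "sem1 \<rho> (star A) = sem2 (fst \<circ> \<rho>) (atoms (so_env \<phi> \<rho>)) A"
proof (induction "depth A" arbitrary: A \<rho> rule: less_induct)
  case less
  note code = assms[unfolded is_coding_def]
  show ?case
  proof (cases A)
    case Bot2
    then show ?thesis using code by simp
  next
    case (Atom2 X ts)
    then show ?thesis using code by (simp add: atoms_def so_env_def)
  next
    case (Bin2 c B C)
    then show ?thesis using code less[of B] less[of C] by simp
  next
    case (Q2 q v B)
    \<comment> \<open>Changing the individual at \<open>y\<close> affects the term variable
      \<open>y\<close> and every second-order variable coded by \<open>y\<close>; none of them is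
      free in \<open>B\<close>, as \<open>y\<close> is fresh for \<open>star B\<close>.\<close>
    have upd_agree: "agree (free2 B - {v}) (fst \<circ> \<rho>(y := d)) (atoms (so_env \<phi> (\<rho>(y := d))))
        (fst \<circ> \<rho>) (atoms (so_env \<phi> \<rho>))" if "y \<notin> free1 (star B)" for y d
      using that free1_star[OF assms, of B] by (auto simp: agree_def atoms_def so_env_def)
    show ?thesis
    proof (cases v)
      case (FO x)
      with Q2 code obtain y where y: "y \<notin> free1 (star B)"
        and A: "star A = Q1 q y (star (fosubst2 x (Var y) B))"
        by metis
      have "sem1 (\<rho>(y := d)) (star (fosubst2 x (Var y) B)) =
          sem2 ((fst \<circ> \<rho>)(x := fst d)) (atoms (so_env \<phi> \<rho>)) B" for d
      proof -
        have "sem1 (\<rho>(y := d)) (star (fosubst2 x (Var y) B)) =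
            sem2 ((fst \<circ> \<rho>(y := d))(x := fst d)) (atoms (so_env \<phi> (\<rho>(y := d)))) B"
          using less[of "fosubst2 x (Var y) B" "\<rho>(y := d)"] Q2 by (simp add: sem2_fosubst2)
        also have "\<dots> = sem2 ((fst \<circ> \<rho>)(x := fst d)) (atoms (so_env \<phi> \<rho>)) B"
          using upd_agree[OF y, of d] FO by (intro sem2_cong) (auto simp: agree_def)
        finally show ?thesis .
      qed
      moreover have range: "fst ` {d :: 'f indiv. wft S (fst d)} = {t. wft S t}"
      proof -
        have "t \<in> fst ` {d :: 'f indiv. wft S (fst d)}" if "wft S t" for t
          using that by (intro image_eqI[of _ _ "(t, \<lambda>_. 0)"]) auto
        then show ?thesis by auto
      qed
      ultimately show ?thesis
        using A Q2 FO
          image_factor[OF range, of "\<lambda>t. sem2 ((fst \<circ> \<rho>)(x := t)) (atoms (so_env \<phi> \<rho>)) B"]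
        by simp
    next
      case (SO n X)
      with Q2 code obtain y Y where y: "y \<notin> free1 (star B)" and Y: "\<phi> n Y = y"
        and A: "star A = Q1 q y (star (sorename n X Y B))"
        by metis
      have "sem1 (\<rho>(y := d)) (star (sorename n X Y B)) =
          sem2 (fst \<circ> \<rho>) (updv (atoms (so_env \<phi> \<rho>)) n X (\<lambda>ts. prov (Atom2 (snd d n) ts))) B" for d
      proof -
        let ?r = "atoms (so_env \<phi> (\<rho>(y := d)))"
        have "sem1 (\<rho>(y := d)) (star (sorename n X Y B)) =
            sem2 (fst \<circ> \<rho>(y := d)) (updv ?r n X (?r Y)) B"
          using less[of "sorename n X Y B" "\<rho>(y := d)"] Q2 by (simp add: sem2_sorename)
        also have "\<dots> = sem2 (fst \<circ> \<rho>)
            (updv (atoms (so_env \<phi> \<rho>)) n X (\<lambda>ts. prov (Atom2 (snd d n) ts))) B"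
        proof (rule sem2_cong)
          have "updv ?r n X (?r Y) = updv ?r n X (\<lambda>ts. prov (Atom2 (snd d n) ts))"
            using Y by (auto simp: updv_def atoms_def so_env_def fun_eq_iff)
          then show "agree (free2 B) (fst \<circ> \<rho>(y := d)) (updv ?r n X (?r Y)) (fst \<circ> \<rho>)
              (updv (atoms (so_env \<phi> \<rho>)) n X (\<lambda>ts. prov (Atom2 (snd d n) ts)))"
            using upd_agree[OF y, of d] SO by (simp only: agree_updv)
        qed
        finally show ?thesis .
      qed
      moreover have range: "(\<lambda>d. snd d n) ` {d :: 'f indiv. wft S (fst d)} = UNIV"
      proof -
        have "Z \<in> (\<lambda>d. snd d n) ` {d :: 'f indiv. wft S (fst d)}" for Z
          by (rule image_eqI[of _ _ "(Var 0, \<lambda>_. Z)"]) auto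
        then show ?thesis by blast
      qed
      ultimately show ?thesis
        using A Q2 SO
          image_factor[OF range,
            of "\<lambda>Z. sem2 (fst \<circ> \<rho>) (updv (atoms (so_env \<phi> \<rho>)) n X (\<lambda>ts. prov (Atom2 Z ts))) B"]
        by simp
    qed
  qed
qed

end

theorem theorem2:
  fixes S :: "'f signature"
    and \<phi> :: "nat \<Rightarrow> svar \<Rightarrow> fvar"
    and star :: "'f fm2 \<Rightarrow> 'f fm1"
    and \<Gamma> :: "'f fm2 set" and A :: "'f fm2" and k :: logic
  assumes "countable S"
    and "\<forall>n. bij (\<phi> n)"
    and "is_coding \<phi> star"
    and "\<forall>F\<in>\<Gamma>. wf2 S F" and "wf2 S A"
    and "derives1 S k (star ` \<Gamma> \<union> SC1 star S) (star A)"
  shows "derives2 S k \<Gamma> A"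
proof -
  \<comment> \<open>Each variable denotes itself together with the second-order variables it codes.
    Under this environment codes are evaluated at the identity valuation, where values are
    provability sets.\<close>
  define \<rho> :: "fvar \<Rightarrow> 'f indiv" where "\<rho> = (\<lambda>x. (Var x, \<lambda>n. inv (\<phi> n) x))"
  have "so_env \<phi> \<rho> = (\<lambda>_ X. X)"
    using assms(2) by (simp add: so_env_def \<rho>_def fun_eq_iff bij_is_inj)
  moreover have "fst \<circ> \<rho> = Var"
    by (simp add: \<rho>_def fun_eq_iff)
  ultimately have sem: "sem1 S k \<rho> (star F) = sem2 S k Var (atoms S k (\<lambda>_ X. X)) F" for F
    by (simp add: sem1_star[OF assms(3)])
  obtain \<Delta> where \<Delta>: "\<Delta> \<subseteq> star ` \<Gamma> \<union> SC1 star S" "finite \<Delta>" "nd1 S k \<Delta> (star A)"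
    using assms(6) by (auto simp: derives1_def)
  \<comment> \<open>Finitely many preimages of the assumptions used form the context; the
    comprehension assumptions add nothing to it, as they hold in every context.\<close>
  obtain \<Gamma>0 where \<Gamma>0: "\<Gamma>0 \<subseteq> \<Gamma>" "finite \<Gamma>0" "\<Delta> \<inter> star ` \<Gamma> = star ` \<Gamma>0"
    using finite_subset_image[of "\<Delta> \<inter> star ` \<Gamma>" star \<Gamma>] \<Delta>(2) by auto
  have ctx: "ctx S \<Gamma>0"
    using \<Gamma>0 assms(4) by (auto simp: ctx_def)
  have "\<Gamma>0 \<in> sem1 S k \<rho> F" if F: "F \<in> \<Delta>" for F
  proof (cases "F \<in> star ` \<Gamma>")
    case True
    then obtain B where B: "F = star B" "B \<in> \<Gamma>0" using F \<Gamma>0(3) by auto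
    then have "wf2 S B" using \<Gamma>0 assms(4) by auto
    with B ctx show ?thesis by (simp add: sem sem2_Var_idv prov_assm)
  next
    case False
    then obtain B where "F = star B" "B \<in> SC2 S" using F \<Delta>(1) by (auto simp: SC1_def)
    with ctx show ?thesis by (simp add: sem SC2_valid)
  qed
  then have "\<Gamma>0 \<in> sem1 S k \<rho> (star A)"
    using sem1_sound[OF \<Delta>(3) _ ctx, of \<rho>] by (simp add: \<rho>_def)
  then have "nd2 S k \<Gamma>0 A"
    using assms(5) by (simp add: sem sem2_Var_idv prov_nd2)
  with \<Gamma>0 show ?thesis by (auto simp: derives2_def)
qed

end
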